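(* Let $\alpha$ be a fixed partition. Then, as formal power series in $t$, $$\frac{\sum_{n\geq0}F_{2n}^{\alpha}\,\frac{t^n}{n!}}{\sum_{n\geq0}F_{-2n}^{\alpha}\,\frac{(x^2y^2zt)^n}{n!}}=\exp\big((x+y)t\big).$$
   Context: Partitions are identified with Young diagrams (cell $(i,j)$ in row $i$, column $j$); for $\mu\subseteq\lambda$, $\lambda/\mu$ is the set of cells of $\lambda$ not in $\mu$, $\lambda/\mu\vdash n$ means it has $n$ cells. $v(\lambda/\mu),h(\lambda/\mu),d(\lambda/\mu)$ are the numbers of cells of $\lambda/\mu$ in even rows, in even columns, and in both even rows and even columns. A standard Young tableau (SYT) of shape $\lambda/\mu\vdash n$ is a bijection $T$ from its cells to $[n]$ with $T(i,j)\le T(i',j')$ whenever $i\le i',j\le j'$. Write $(i,j)\lhd(i',j')$ if $i<i'$ or ($i=i'$, $j<j'$). For an SYT $T$ of straight shape, ${\rm sign}(T)=(-1)^{\#\{(a,b):a\lhd b,\,T(a)>T(b)\}}$. For $T_1$ of shape $\nu/\mu\vdash k$ and $T_2$ of shape $\lambda/\nu$, $T_1\diamond T_2$ is the SYT of shape $\lambda/\mu$ equal to $T_1$ on $\nu/\mu$ and $T_2+k$ on $\lambda/\nu$. For $T$ of shape $\lambda/\mu$, ${\rm sign}(T)={\rm sign}(T_0){\rm sign}(T_0\diamond T)$ for any SYT $T_0$ of shape $\mu$ (independent of $T_0$), and $I_{\lambda/\mu}=\sum_T{\rm sign}(T)$ over SYTs of shape $\lambda/\mu$. For $n\ge0$: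 $F_{2n}^\alpha=\sum_{\lambda:\ \lambda/\alpha\vdash 2n}x^{v(\lambda/\alpha)}y^{h(\lambda/\alpha)}z^{d(\lambda/\alpha)}I_{\lambda/\alpha}$ and $F_{-2n}^\alpha=\sum_{\mu:\ \alpha/\mu\vdash 2n}(-x)^{-v(\alpha/\mu)}y^{-h(\alpha/\mu)}z^{-d(\alpha/\mu)}I_{\alpha/\mu}$. *)

theory Defs
  imports Complex_Main "HOL-Library.FuncSet"
    "HOL-Computational_Algebra.Formal_Power_Series"
begin

type_synonym cell = "nat \<times> nat"

definition is_partition :: "nat list \<Rightarrow> bool" where
  "is_partition lam \<longleftrightarrow> sorted_wrt (\<ge>) lam \<and> 0 \<notin> set lam"

text \<open>Rows and columns are numbered from 1, whereas list positions start at 0.\<close>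

definition young :: "nat list \<Rightarrow> cell set" where
  "young lam = {(i, j). 1 \<le> i \<and> i \<le> length lam \<and> 1 \<le> j \<and> j \<le> lam ! (i - 1)}"

definition skew :: "nat list \<Rightarrow> nat list \<Rightarrow> cell set" where
  "skew lam mu = young lam - young mu"

definition v_stat :: "cell set \<Rightarrow> nat" where
  "v_stat D = card {(i, j) \<in> D. even i}"

definition h_stat :: "cell set \<Rightarrow> nat" where
  "h_stat D = card {(i, j) \<in> D. even j}"

definition d_stat :: "cell set \<Rightarrow> nat" where
  "d_stat D = card {(i, j) \<in> D. even i \<and> even j}"

text \<open>Tableaux are extensional functions (\<open>undefined\<close> off the shape), so that each tableau
  is represented exactly once in sums.\<close>

definition SYT :: "cell set \<Rightarrow> (cell \<Rightarrow> nat) set" where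
  "SYT D = {T \<in> extensional D. bij_betw T D {1..card D} \<and>
     (\<forall>i j i' j'. (i, j) \<in> D \<longrightarrow> (i', j') \<in> D \<longrightarrow> i \<le> i' \<longrightarrow> j \<le> j' \<longrightarrow> T (i, j) \<le> T (i', j'))}"

definition cell_less :: "cell \<Rightarrow> cell \<Rightarrow> bool"  (infix "\<lhd>" 50) where
  "a \<lhd> b \<longleftrightarrow> fst a < fst b \<or> (fst a = fst b \<and> snd a < snd b)"

definition straight_sign :: "nat list \<Rightarrow> (cell \<Rightarrow> nat) \<Rightarrow> int" where
  "straight_sign lam T =
     (- 1) ^ card {(a, b). a \<in> young lam \<and> b \<in> young lam \<and> a \<lhd> b \<and> T a > T b}"

text \<open>\<open>diamond lam nu mu T1 T2\<close> glues \<open>T1\<close> of shape \<open>nu/mu\<close> and \<open>T2\<close> of shape \<open>lam/nu\<close>.\<close>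

definition diamond ::
  "nat list \<Rightarrow> nat list \<Rightarrow> nat list \<Rightarrow> (cell \<Rightarrow> nat) \<Rightarrow> (cell \<Rightarrow> nat) \<Rightarrow> (cell \<Rightarrow> nat)" where
  "diamond lam nu mu T1 T2 =
     restrict (\<lambda>c. if c \<in> skew nu mu then T1 c else T2 c + card (skew nu mu)) (skew lam mu)"

text \<open>The sign of a skew tableau, by means of an arbitrary tableau of the inner shape; the choice
  is immaterial by \<open>skew_sign_independent\<close> below.\<close>

definition skew_sign :: "nat list \<Rightarrow> nat list \<Rightarrow> (cell \<Rightarrow> nat) \<Rightarrow> int" where
  "skew_sign lam mu T =
     (let T0 = (SOME T0. T0 \<in> SYT (young mu))
      in straight_sign mu T0 * straight_sign lam (diamond lam mu [] T0 T))"

definition sign_imbalance :: "nat list \<Rightarrow> nat list \<Rightarrow> int" where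
  "sign_imbalance lam mu = (\<Sum>T\<in>SYT (skew lam mu). skew_sign lam mu T)"

definition F_plus :: "'a::field_char_0 \<Rightarrow> 'a \<Rightarrow> 'a \<Rightarrow> nat list \<Rightarrow> nat \<Rightarrow> 'a" where
  "F_plus x y z alpha m =
     (\<Sum>lam | is_partition lam \<and> young alpha \<subseteq> young lam \<and> card (skew lam alpha) = m.
        x ^ v_stat (skew lam alpha) * y ^ h_stat (skew lam alpha) * z ^ d_stat (skew lam alpha)
          * of_int (sign_imbalance lam alpha))"

definition F_minus :: "'a::field_char_0 \<Rightarrow> 'a \<Rightarrow> 'a \<Rightarrow> nat list \<Rightarrow> nat \<Rightarrow> 'a" where
  "F_minus x y z alpha m =
     (\<Sum>mu | is_partition mu \<and> young mu \<subseteq> young alpha \<and> card (skew alpha mu) = m.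
        (- x) powi (- int (v_stat (skew alpha mu))) * y powi (- int (h_stat (skew alpha mu)))
          * z powi (- int (d_stat (skew alpha mu))) * of_int (sign_imbalance alpha mu))"

lemma finite_young: "finite (young lam)"
proof (rule finite_subset)
  show "young lam \<subseteq> {..length lam} \<times> {..sum_list lam}"
  proof
    fix c assume "c \<in> young lam"
    then obtain i j where c: "c = (i, j)" "1 \<le> i" "i \<le> length lam" "j \<le> lam ! (i - 1)"
      by (auto simp: young_def)
    then have "lam ! (i - 1) \<in> set lam" by simp
    then have "lam ! (i - 1) \<le> sum_list lam" by (simp add: member_le_sum_list)
    with c show "c \<in> {..length lam} \<times> {..sum_list lam}" by simp
  qed
qed simp

lemma straight_sign_diamond:
  assumes sub: "young mu \<subseteq> young lam" and T0: "T0 \<in> SYT (young mu)" and T: "T \<in> SYT (skew lam mu)"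
  shows "straight_sign mu T0 * straight_sign lam (diamond lam mu [] T0 T) =
    (- 1) ^ card ({(a, b). a \<in> skew lam mu \<and> b \<in> skew lam mu \<and> a \<lhd> b \<and> T a > T b} \<union>
      {(a, b). a \<in> skew lam mu \<and> b \<in> young mu \<and> a \<lhd> b})"
proof -
  define U where "U = diamond lam mu [] T0 T"
  define A where "A = {(a, b). a \<in> young mu \<and> b \<in> young mu \<and> a \<lhd> b \<and> T0 a > T0 b}"
  define B where "B = {(a, b). a \<in> skew lam mu \<and> b \<in> skew lam mu \<and> a \<lhd> b \<and> T a > T b} \<union>
      {(a, b). a \<in> skew lam mu \<and> b \<in> young mu \<and> a \<lhd> b}"
  have empty: "skew nu [] = young nu" for nu
    by (auto simp: skew_def young_def)
  have Uin: "U c = T0 c" if "c \<in> young mu" for c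
    using that sub by (auto simp: U_def diamond_def empty)
  have Uout: "U c = T c + card (young mu)" if "c \<in> skew lam mu" for c
    using that by (auto simp: U_def diamond_def empty) (auto simp: skew_def)
  have le: "T0 c \<le> card (young mu)" if "c \<in> young mu" for c
    using T0 that by (auto simp: SYT_def bij_betw_def)
  have ge: "1 \<le> T c" if "c \<in> skew lam mu" for c
  proof -
    have "T c \<in> {1..card (skew lam mu)}"
      using T that by (auto simp: SYT_def bij_betw_def)
    then show ?thesis by simp
  qed
  have lam: "c \<in> young lam \<longleftrightarrow> c \<in> young mu \<or> c \<in> skew lam mu" for c
    using sub by (auto simp: skew_def)
  have inv: "a \<in> young lam \<and> b \<in> young lam \<and> a \<lhd> b \<and> U a > U b \<longleftrightarrow> (a, b) \<in> A \<union> B" for a b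
  proof -
    have disj: "c \<in> young mu \<Longrightarrow> c \<notin> skew lam mu" for c by (simp add: skew_def)
    consider "a \<in> young mu" "b \<in> young mu" | "a \<in> young mu" "b \<in> skew lam mu"
      | "a \<in> skew lam mu" "b \<in> young mu" | "a \<in> skew lam mu" "b \<in> skew lam mu"
      | "a \<notin> young lam \<or> b \<notin> young lam"
      using lam by blast
    then show ?thesis
    proof cases
      case 1 then show ?thesis using disj[of a] disj[of b] by (auto simp: A_def B_def Uin lam)
    next
      case 2 then show ?thesis using disj[of a] disj[of b] le[of a] by (auto simp: A_def B_def Uin Uout lam)
    next
      case 3 then show ?thesis using disj[of a] disj[of b] le[of b] ge[of a] by (auto simp: A_def B_def Uin Uout lam)
    next
      case 4 then show ?thesis using disj[of a] disj[of b] by (auto simp: A_def B_def Uout lam)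
    next
      case 5 then show ?thesis by (auto simp: A_def B_def lam)
    qed
  qed
  have "A \<subseteq> young mu \<times> young mu" by (auto simp: A_def)
  then have finA: "finite A" using finite_young finite_subset by blast
  have "B \<subseteq> young lam \<times> young lam" using sub by (auto simp: B_def skew_def)
  then have finB: "finite B" using finite_young finite_subset by blast
  have "A \<inter> B = {}" by (auto simp: A_def B_def skew_def)
  then have "card (A \<union> B) = card A + card B" using finA finB by (rule card_Un_disjoint[rotated 2])
  moreover have "{(a, b). a \<in> young lam \<and> b \<in> young lam \<and> a \<lhd> b \<and> U a > U b} = A \<union> B"
    using inv by auto
  ultimately have "straight_sign lam U = (- 1) ^ (card A + card B)"
    by (simp add: straight_sign_def)
  moreover have "straight_sign mu T0 = (- 1) ^ card A"
    by (simp add: straight_sign_def A_def)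
  ultimately have "straight_sign mu T0 * straight_sign lam U = (- 1) ^ card B"
    by (simp add: power_add flip: mult.assoc power_mult_distrib)
  then show ?thesis by (simp add: U_def B_def)
qed

lemma skew_sign_independent:
  assumes "young mu \<subseteq> young lam" "T0 \<in> SYT (young mu)" "T \<in> SYT (skew lam mu)"
  shows "skew_sign lam mu T = straight_sign mu T0 * straight_sign lam (diamond lam mu [] T0 T)"
proof -
  have "(SOME T0. T0 \<in> SYT (young mu)) \<in> SYT (young mu)"
    using assms(2) by (rule someI[where P = "\<lambda>T0. T0 \<in> SYT (young mu)"])
  then show ?thesis
    using straight_sign_diamond[OF assms(1) _ assms(3)] assms(2) by (simp add: skew_sign_def Let_def)
qed

end

theory Submission
  imports Defs "HOL-Library.Product_Order"
begin

text \<open>On functions of Young diagrams let \<open>U\<close> (\<open>D\<close>) sum over all ways of adding (removing) one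
  cell \<open>c\<close>, with the sign given by the number of cells after \<open>c\<close> in reading order and with the
  weight of \<open>c\<close> occurring in \<open>F_plus\<close> (\<open>F_minus\<close>). Deleting the smallest or the largest entry of a
  tableau gives \<open>F_plus = U\<^sup>m 1\<close> and \<open>F_minus = D\<^sup>m 1\<close>. The signs make operations at different
  corners anticommute, and the product of the two weights of a cell in row \<open>i\<close> is \<open>(-1)\<^bsup>i+1\<^esup>\<close>;
  since the rows with an addable corner are row 1 and the rows below those with a removable one,
  \<open>UD + DU = 1\<close>, so \<open>U\<^sup>2\<close> commutes with \<open>D\<close>. A skew diagram with two cells has imbalance 0 unless
  it is a domino. Horizontal dominoes telescope over the rows, like corners, and vertical ones over
  the columns, whence \<open>U\<^sup>2 1 = q D\<^sup>2 1 + (x + y)\<close> for \<open>q = x\<^sup>2y\<^sup>2z\<close>. By commutation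
  \<open>b(n, k) = q\<^sup>k U\<^bsup>2n\<^esup> D\<^bsup>2k\<^esup> 1\<close> satisfies \<open>b(n + 1, k) = b(n, k + 1) + (x + y) b(n, k)\<close>: the generating
  functions \<open>E\<^sub>k\<close> of \<open>b(n, k) / n!\<close> satisfy \<open>E\<^sub>k' = E\<^sub>k\<^sub>+\<^sub>1 + (x + y) E\<^sub>k\<close>. So the \<open>k\<close>-th derivative of
  \<open>exp(-(x + y)t) E\<^sub>0\<close> at 0 is \<open>b(0, k)\<close>, which is the theorem.\<close>

subsection \<open>Young diagrams as sets of cells\<close>

definition diagram :: "cell set \<Rightarrow> bool" where
  "diagram S \<longleftrightarrow> finite S \<and> S \<subseteq> {(1, 1)..} \<and> (\<forall>c\<in>S. {(1, 1)..c} \<subseteq> S)"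

lemma diagramI:
  assumes "finite S" "\<And>c. c \<in> S \<Longrightarrow> (1, 1) \<le> c"
    "\<And>c d. d \<in> S \<Longrightarrow> (1, 1) \<le> c \<Longrightarrow> c \<le> d \<Longrightarrow> c \<in> S"
  shows "diagram S"
  unfolding diagram_def using assms(1) by (auto intro: assms(2,3) simp del: One_nat_def)

lemma diagram_finite: "diagram S \<Longrightarrow> finite S"
  by (simp add: diagram_def)

lemma diagram_pos: "diagram S \<Longrightarrow> c \<in> S \<Longrightarrow> (1, 1) \<le> c"
  unfolding diagram_def by (meson atLeast_iff subsetD)

lemma diagram_pos_Pair: "diagram S \<Longrightarrow> (i, j) \<in> S \<Longrightarrow> 1 \<le> i \<and> 1 \<le> j"
  using diagram_pos[of S "(i, j)"] by simp

lemma diagram_downward: "diagram S \<Longrightarrow> d \<in> S \<Longrightarrow> (1, 1) \<le> c \<Longrightarrow> c \<le> d \<Longrightarrow> c \<in> S"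
  unfolding diagram_def by (meson atLeastAtMost_iff subsetD)

lemma diagram_Un: "diagram S \<Longrightarrow> diagram T \<Longrightarrow> diagram (S \<union> T)"
  unfolding diagram_def by (simp add: ball_Un le_supI1 le_supI2)

lemma diagram_Int: "diagram S \<Longrightarrow> diagram T \<Longrightarrow> diagram (S \<inter> T)"
  unfolding diagram_def by (simp add: le_infI1)

lemma mem_swap_image: "c \<in> prod.swap ` A \<longleftrightarrow> prod.swap c \<in> A"
  by force

lemma diagram_swap:
  assumes "diagram S" shows "diagram (prod.swap ` S)"
proof (rule diagramI)
  show "finite (prod.swap ` S)" using diagram_finite[OF assms] by simp
  show "(1, 1) \<le> c" if "c \<in> prod.swap ` S" for c
    using that by (auto dest: diagram_pos_Pair[OF assms])
  show "c \<in> prod.swap ` S" if "d \<in> prod.swap ` S" "(1, 1) \<le> c" "c \<le> d" for c d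
  proof -
    have "prod.swap c \<in> S"
      using that unfolding mem_swap_image
      by (elim diagram_downward[OF assms]) (auto simp: less_eq_prod_def)
    then show ?thesis by (simp only: mem_swap_image)
  qed
qed

lemma diagram_swap_iff: "diagram (prod.swap ` S) \<longleftrightarrow> diagram S"
  using diagram_swap[of S] diagram_swap[of "prod.swap ` S"] by (auto simp: image_image)

lemma diagram_subset_square:
  assumes "diagram S" shows "S \<subseteq> {..card S} \<times> {..card S}"
proof
  fix c assume c: "c \<in> S"
  have pos: "1 \<le> fst c" "1 \<le> snd c" using diagram_pos[OF assms c] by (auto simp: less_eq_prod_def)
  have "{(1, 1)..c} \<subseteq> S" using assms c unfolding diagram_def by blast
  then have "card {(1, 1)..c} \<le> card S" by (rule card_mono[OF diagram_finite[OF assms]])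
  then have "fst c * snd c \<le> card S" by (simp add: atLeastAtMost_prod_eq card_cartesian_product)
  moreover have "fst c \<le> fst c * snd c" "snd c \<le> fst c * snd c" using pos by auto
  ultimately show "c \<in> {..card S} \<times> {..card S}" unfolding mem_Times_iff atMost_iff by linarith
qed

definition row_len :: "cell set \<Rightarrow> nat \<Rightarrow> nat" where
  "row_len S i = card {j. (i, j) \<in> S}"

lemma finite_row: "finite S \<Longrightarrow> finite {j. (i, j) \<in> S}"
  using finite_vimageI[of S "Pair i"] by (simp add: vimage_def inj_on_def)

lemma nat_interval_if_downward_closed:
  fixes A :: "nat set"
  assumes "finite A" "\<And>j. j \<in> A \<Longrightarrow> 1 \<le> j" "\<And>j j'. j' \<in> A \<Longrightarrow> 1 \<le> j \<Longrightarrow> j \<le> j' \<Longrightarrow> j \<in> A"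
  shows "A = {1..card A}"
proof (cases "A = {}")
  case False
  have "A = {1..Max A}"
  proof (intro set_eqI iffI)
    show "j \<in> {1..Max A}" if "j \<in> A" for j using that assms(1,2) by simp
    show "j \<in> A" if "j \<in> {1..Max A}" for j
      using that assms(3)[OF Max_in[OF assms(1) False], of j] by simp
  qed
  then show ?thesis by (metis card_atLeastAtMost diff_Suc_1)
qed simp

lemma mem_diagram_iff:
  assumes S: "diagram S"
  shows "(i, j) \<in> S \<longleftrightarrow> 1 \<le> i \<and> 1 \<le> j \<and> j \<le> row_len S i"
proof (cases "1 \<le> i")
  case True
  have "{j. (i, j) \<in> S} = {1..row_len S i}"
    unfolding row_len_def
  proof (rule nat_interval_if_downward_closed)
    show "finite {j. (i, j) \<in> S}" by (rule finite_row[OF diagram_finite[OF S]])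
    show "1 \<le> j" if "j \<in> {j. (i, j) \<in> S}" for j using that diagram_pos_Pair[OF S] by blast
    show "j \<in> {j. (i, j) \<in> S}" if "j' \<in> {j. (i, j) \<in> S}" "1 \<le> j" "j \<le> j'" for j j'
      using that True diagram_downward[OF S, of "(i, j')" "(i, j)"] by simp
  qed
  then show ?thesis using True by auto
next
  case False
  then show ?thesis using diagram_pos_Pair[OF S] by blast
qed

lemma row_len_antimono:
  assumes S: "diagram S" and "1 \<le> i" "i \<le> i'"
  shows "row_len S i' \<le> row_len S i"
proof (cases "row_len S i' = 0")
  case False
  then have "(i', row_len S i') \<in> S"
    using assms(2,3) by (simp add: mem_diagram_iff[OF S, of i' "row_len S i'"])
  then have "(i, row_len S i') \<in> S"
    using assms(2,3) False diagram_downward[OF S, of "(i', row_len S i')" "(i, row_len S i')"]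
    by simp
  then show ?thesis by (simp add: mem_diagram_iff[OF S, of i "row_len S i'"])
qed simp

lemma diagram_if_row_lengths:
  assumes fin: "finite S" and mem: "\<And>i j. (i, j) \<in> S \<longleftrightarrow> 1 \<le> i \<and> 1 \<le> j \<and> j \<le> r i"
    and desc: "\<And>i. 1 \<le> i \<Longrightarrow> r (Suc i) \<le> r i"
  shows "diagram S"
proof (rule diagramI[OF fin])
  have antimono: "r i' \<le> r i" if "i \<le> i'" "1 \<le> i" for i i'
    using that by (induction rule: dec_induct) (simp_all add: order_trans[OF desc])
  show "(1, 1) \<le> c" if "c \<in> S" for c
    using that by (cases c) (simp add: mem)
  show "c \<in> S" if "d \<in> S" "(1, 1) \<le> c" "c \<le> d" for c d
    using that antimono[of "fst c" "fst d"] by (cases c; cases d) (auto simp: mem)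
qed

subsection \<open>Strips at the boundary of a diagram\<close>

definition row_strip :: "nat \<Rightarrow> cell \<Rightarrow> cell set" where
  "row_strip k c = {fst c} \<times> {snd c..<snd c + k}"

definition column_strip :: "nat \<Rightarrow> cell \<Rightarrow> cell set" where
  "column_strip k c = {fst c..<fst c + k} \<times> {snd c}"

definition addable_at :: "(cell \<Rightarrow> cell set) \<Rightarrow> cell set \<Rightarrow> cell set" where
  "addable_at B S = {c. B c \<inter> S = {} \<and> diagram (S \<union> B c)}"

definition removable_at :: "(cell \<Rightarrow> cell set) \<Rightarrow> cell set \<Rightarrow> cell set" where
  "removable_at B S = {c. B c \<subseteq> S \<and> diagram (S - B c)}"

definition row_drops :: "nat \<Rightarrow> cell set \<Rightarrow> nat set" where
  "row_drops k S = {i. 1 \<le> i \<and> row_len S (Suc i) + k \<le> row_len S i}"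

lemma finite_row_strip: "finite (row_strip k c)"
  by (simp add: row_strip_def)

lemma finite_row_drops:
  assumes "diagram S" "1 \<le> k" shows "finite (row_drops k S)"
proof (rule finite_surj[of S _ fst])
  show "row_drops k S \<subseteq> fst ` S"
  proof
    fix i assume "i \<in> row_drops k S"
    then have "(i, 1) \<in> S" using assms(2) by (auto simp: row_drops_def mem_diagram_iff[OF assms(1)])
    then show "i \<in> fst ` S" by force
  qed
qed (rule diagram_finite[OF assms(1)])

lemma row_len_Un_row_strip:
  assumes "finite S" "row_strip k (i, j) \<inter> S = {}"
  shows "row_len (S \<union> row_strip k (i, j)) = (row_len S)(i := row_len S i + k)"
proof
  fix i'
  have "{b. (i, b) \<in> S \<union> row_strip k (i, j)} = {b. (i, b) \<in> S} \<union> {j..<j + k}"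
    by (auto simp: row_strip_def)
  moreover have "{b. (i, b) \<in> S} \<inter> {j..<j + k} = {}"
    using assms(2) by (auto simp: row_strip_def)
  ultimately have "row_len (S \<union> row_strip k (i, j)) i = row_len S i + k"
    by (simp add: row_len_def card_Un_disjoint finite_row[OF assms(1)])
  moreover have "row_len (S \<union> row_strip k (i, j)) i' = row_len S i'" if "i' \<noteq> i"
    using that by (simp add: row_len_def row_strip_def)
  ultimately show "row_len (S \<union> row_strip k (i, j)) i' = ((row_len S)(i := row_len S i + k)) i'"
    by simp
qed

lemma row_strip_start:
  assumes S: "diagram S" and T: "diagram (S \<union> row_strip k (i, j))"
    and disj: "row_strip k (i, j) \<inter> S = {}" and k: "1 \<le> k"
  shows "1 \<le> i" and "j = Suc (row_len S i)"
proof -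
  have start: "(i, j) \<in> row_strip k (i, j)" using k by (simp add: row_strip_def)
  then have pos: "1 \<le> i" "1 \<le> j" using diagram_pos_Pair[OF T, of i j] by auto
  then show "1 \<le> i" by simp
  have "row_len S i < j"
    using start disj pos mem_diagram_iff[OF S, of i j] by (auto simp: disjoint_iff)
  have "(i, Suc (row_len S i)) \<in> S \<union> row_strip k (i, j)"
    unfolding mem_diagram_iff[OF T] row_len_Un_row_strip[OF diagram_finite[OF S] disj]
    using pos k by simp
  then have "j \<le> Suc (row_len S i)"
    by (auto simp: mem_diagram_iff[OF S] row_strip_def)
  with \<open>row_len S i < j\<close> show "j = Suc (row_len S i)" by simp
qed

lemma addable_at_row_strip_eq:
  assumes S: "diagram S" and k: "1 \<le> k"
  shows "addable_at (row_strip k) S =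
    (\<lambda>i. (i, Suc (row_len S i))) ` insert 1 (Suc ` row_drops k S)" (is "_ = ?f ` ?I")
proof (intro set_eqI iffI)
  fix c assume "c \<in> addable_at (row_strip k) S"
  then have disj: "row_strip k c \<inter> S = {}" and T: "diagram (S \<union> row_strip k c)"
    by (auto simp: addable_at_def)
  obtain i j where c: "c = (i, j)" by (cases c)
  have start: "1 \<le> i" "j = Suc (row_len S i)"
    using row_strip_start[OF S T[unfolded c] disj[unfolded c] k] by auto
  have "i \<in> Suc ` row_drops k S" if "i \<noteq> 1"
  proof -
    define i' where "i' = i - 1"
    have i': "i = Suc i'" "1 \<le> i'" using start(1) that by (auto simp: i'_def)
    have "row_len S (Suc i') + k \<le> row_len S i'"
      using row_len_antimono[OF T, of i' i] i'
        row_len_Un_row_strip[OF diagram_finite[OF S] disj[unfolded c]] c by simp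
    then show ?thesis using i' by (simp add: row_drops_def)
  qed
  then show "c \<in> ?f ` ?I" using start c by blast
next
  fix c assume "c \<in> ?f ` ?I"
  then obtain i where c: "c = (i, Suc (row_len S i))" and i: "i = 1 \<or> i \<in> Suc ` row_drops k S"
    by blast
  have disj: "row_strip k c \<inter> S = {}" by (auto simp: c row_strip_def mem_diagram_iff[OF S])
  have "diagram (S \<union> row_strip k c)"
  proof (rule diagram_if_row_lengths[where r = "(row_len S)(i := row_len S i + k)"])
    show "finite (S \<union> row_strip k c)" using diagram_finite[OF S] by (simp add: finite_row_strip)
    show "(a, b) \<in> S \<union> row_strip k c \<longleftrightarrow>
        1 \<le> a \<and> 1 \<le> b \<and> b \<le> ((row_len S)(i := row_len S i + k)) a" for a b
      using i by (auto simp: c row_strip_def mem_diagram_iff[OF S] row_drops_def)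
    show "((row_len S)(i := row_len S i + k)) (Suc a) \<le> ((row_len S)(i := row_len S i + k)) a"
      if "1 \<le> a" for a
      using i that row_len_antimono[OF S that, of "Suc a"] by (auto simp: row_drops_def)
  qed
  with disj show "c \<in> addable_at (row_strip k) S" by (simp add: addable_at_def)
qed

lemma removable_at_row_strip_eq:
  assumes S: "diagram S" and k: "1 \<le> k"
  shows "removable_at (row_strip k) S = (\<lambda>i. (i, Suc (row_len S i) - k)) ` row_drops k S"
    (is "_ = ?f ` ?I")
proof (intro set_eqI iffI)
  fix c assume "c \<in> removable_at (row_strip k) S"
  then have sub: "row_strip k c \<subseteq> S" and diff: "diagram (S - row_strip k c)"
    by (auto simp: removable_at_def)
  obtain i j where c: "c = (i, j)" by (cases c)
  define T where "T = S - row_strip k (i, j)"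
  have S_eq: "S = T \<union> row_strip k (i, j)" and T: "diagram T" and disj: "row_strip k (i, j) \<inter> T = {}"
    using sub diff by (auto simp: T_def c)
  have start: "1 \<le> i" "j = Suc (row_len T i)"
    using row_strip_start[OF T _ disj k] S S_eq by auto
  have "row_len S = (row_len T)(i := row_len T i + k)"
    unfolding S_eq using row_len_Un_row_strip[OF diagram_finite[OF T] disj] .
  then have "i \<in> row_drops k S" "c = ?f i"
    using start row_len_antimono[OF T start(1), of "Suc i"] c by (auto simp: row_drops_def)
  then show "c \<in> ?f ` ?I" by blast
next
  fix c assume "c \<in> ?f ` ?I"
  then obtain i where c: "c = (i, Suc (row_len S i) - k)" and i: "i \<in> row_drops k S"
    by blast
  have sub: "row_strip k c \<subseteq> S"
    using i by (auto simp: c row_strip_def mem_diagram_iff[OF S] row_drops_def)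
  have "diagram (S - row_strip k c)"
  proof (rule diagram_if_row_lengths[where r = "(row_len S)(i := row_len S i - k)"])
    show "finite (S - row_strip k c)" using diagram_finite[OF S] by simp
    show "(a, b) \<in> S - row_strip k c \<longleftrightarrow>
        1 \<le> a \<and> 1 \<le> b \<and> b \<le> ((row_len S)(i := row_len S i - k)) a" for a b
      using i by (auto simp: c row_strip_def mem_diagram_iff[OF S] row_drops_def)
    show "((row_len S)(i := row_len S i - k)) (Suc a) \<le> ((row_len S)(i := row_len S i - k)) a"
      if "1 \<le> a" for a
      using i that row_len_antimono[OF S that, of "Suc a"] by (auto simp: row_drops_def)
  qed
  with sub show "c \<in> removable_at (row_strip k) S" by (simp add: removable_at_def)
qed

lemma sum_addable_at_row_strip:
  fixes f :: "nat \<Rightarrow> 'b::comm_monoid_add"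
  assumes "diagram S" "1 \<le> k"
  shows "(\<Sum>c\<in>addable_at (row_strip k) S. f (fst c)) =
    f 1 + (\<Sum>c\<in>removable_at (row_strip k) S. f (Suc (fst c)))"
proof -
  have "(\<Sum>c\<in>addable_at (row_strip k) S. f (fst c)) = (\<Sum>i\<in>insert 1 (Suc ` row_drops k S). f i)"
    unfolding addable_at_row_strip_eq[OF assms] by (subst sum.reindex) (auto simp: inj_on_def)
  also have "\<dots> = f 1 + (\<Sum>i\<in>row_drops k S. f (Suc i))"
    using finite_row_drops[OF assms] by (subst sum.insert) (auto simp: row_drops_def sum.reindex)
  also have "(\<Sum>i\<in>row_drops k S. f (Suc i)) = (\<Sum>c\<in>removable_at (row_strip k) S. f (Suc (fst c)))"
    unfolding removable_at_row_strip_eq[OF assms] by (subst sum.reindex) (auto simp: inj_on_def)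
  finally show ?thesis .
qed

lemma swap_row_strip: "prod.swap ` row_strip k (prod.swap c) = column_strip k c"
  by (simp add: row_strip_def column_strip_def product_swap)

lemma addable_at_column_strip_eq:
  "addable_at (column_strip k) S = prod.swap ` addable_at (row_strip k) (prod.swap ` S)"
proof (intro set_eqI)
  fix c
  have "row_strip k (prod.swap c) \<inter> prod.swap ` S = prod.swap ` (column_strip k c \<inter> S)"
    "prod.swap ` S \<union> row_strip k (prod.swap c) = prod.swap ` (S \<union> column_strip k c)"
    unfolding swap_row_strip[symmetric] by (simp_all add: image_Int image_Un image_image)
  then have "prod.swap c \<in> addable_at (row_strip k) (prod.swap ` S) \<longleftrightarrow>
      c \<in> addable_at (column_strip k) S"
    by (simp add: addable_at_def diagram_swap_iff)
  then show "c \<in> addable_at (column_strip k) S \<longleftrightarrow>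
      c \<in> prod.swap ` addable_at (row_strip k) (prod.swap ` S)" by (simp only: mem_swap_image)
qed

lemma removable_at_column_strip_eq:
  "removable_at (column_strip k) S = prod.swap ` removable_at (row_strip k) (prod.swap ` S)"
proof (intro set_eqI)
  fix c
  have "row_strip k (prod.swap c) = prod.swap ` column_strip k c"
    unfolding swap_row_strip[symmetric] by (simp add: image_image)
  then have "row_strip k (prod.swap c) \<subseteq> prod.swap ` S \<longleftrightarrow> column_strip k c \<subseteq> S"
    "prod.swap ` S - row_strip k (prod.swap c) = prod.swap ` (S - column_strip k c)"
    by (simp_all add: inj_image_subset_iff image_set_diff)
  then have "prod.swap c \<in> removable_at (row_strip k) (prod.swap ` S) \<longleftrightarrow>
      c \<in> removable_at (column_strip k) S"
    by (simp add: removable_at_def diagram_swap_iff)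
  then show "c \<in> removable_at (column_strip k) S \<longleftrightarrow>
      c \<in> prod.swap ` removable_at (row_strip k) (prod.swap ` S)" by (simp only: mem_swap_image)
qed

lemma sum_addable_at_column_strip:
  fixes f :: "nat \<Rightarrow> 'b::comm_monoid_add"
  assumes "diagram S" "1 \<le> k"
  shows "(\<Sum>c\<in>addable_at (column_strip k) S. f (snd c)) =
    f 1 + (\<Sum>c\<in>removable_at (column_strip k) S. f (Suc (snd c)))"
  using sum_addable_at_row_strip[OF diagram_swap[OF assms(1)] assms(2), of f]
  by (simp add: addable_at_column_strip_eq removable_at_column_strip_eq sum.reindex)

subsection \<open>Corners\<close>

definition addable :: "cell set \<Rightarrow> cell set" where
  "addable S = {c. diagram S \<and> c \<notin> S \<and> diagram (insert c S)}"

definition removable :: "cell set \<Rightarrow> cell set" where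
  "removable S = {c \<in> S. diagram S \<and> diagram (S - {c})}"

lemma row_strip_1: "row_strip 1 = (\<lambda>c. {c})"
  by (auto simp: row_strip_def prod_eq_iff)

lemma addable_eq_addable_at: "diagram S \<Longrightarrow> addable S = addable_at (row_strip 1) S"
  unfolding addable_def addable_at_def row_strip_1 by simp

lemma removable_eq_removable_at: "diagram S \<Longrightarrow> removable S = removable_at (row_strip 1) S"
  unfolding removable_def removable_at_def row_strip_1 by simp

lemma finite_addable: "finite (addable S)"
proof (cases "diagram S")
  case True
  then show ?thesis
    by (simp add: addable_eq_addable_at addable_at_row_strip_eq finite_row_drops)
qed (simp add: addable_def)

lemma finite_removable: "finite (removable S)"
  by (cases "diagram S") (auto simp: removable_def dest: diagram_finite)

lemma sum_addable:
  fixes f :: "nat \<Rightarrow> 'b::comm_monoid_add"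
  assumes "diagram S"
  shows "(\<Sum>c\<in>addable S. f (fst c)) = f 1 + (\<Sum>c\<in>removable S. f (Suc (fst c)))"
  using sum_addable_at_row_strip[OF assms order_refl]
  by (simp only: addable_eq_addable_at[OF assms] removable_eq_removable_at[OF assms])

subsection \<open>Diagrams of partitions\<close>

lemma mem_young: "(i, j) \<in> young lam \<longleftrightarrow> 1 \<le> i \<and> i \<le> length lam \<and> 1 \<le> j \<and> j \<le> lam ! (i - 1)"
  by (simp add: young_def)

lemma diagram_young:
  assumes "is_partition lam" shows "diagram (young lam)"
proof (rule diagram_if_row_lengths[where r = "\<lambda>i. if i \<le> length lam then lam ! (i - 1) else 0"])
  show "(i, j) \<in> young lam \<longleftrightarrow>
      1 \<le> i \<and> 1 \<le> j \<and> j \<le> (if i \<le> length lam then lam ! (i - 1) else 0)" for i j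
    by (auto simp: mem_young)
  show "(if Suc i \<le> length lam then lam ! (Suc i - 1) else 0)
      \<le> (if i \<le> length lam then lam ! (i - 1) else 0)" if "1 \<le> i" for i
    using assms that by (auto simp: is_partition_def sorted_wrt_iff_nth_less)
qed (rule finite_young)

lemma row_len_young:
  "row_len (young lam) i = (if 1 \<le> i \<and> i \<le> length lam then lam ! (i - 1) else 0)"
proof -
  have "{j. (i, j) \<in> young lam} = (if 1 \<le> i \<and> i \<le> length lam then {1..lam ! (i - 1)} else {})"
    by (auto simp: mem_young)
  then show ?thesis by (simp add: row_len_def)
qed

lemma row_len_young_pos_iff:
  assumes "is_partition lam"
  shows "0 < row_len (young lam) i \<longleftrightarrow> 1 \<le> i \<and> i \<le> length lam"
proof -
  have "0 < lam ! (i - 1)" if "1 \<le> i" "i \<le> length lam"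
  proof -
    have "lam ! (i - 1) \<in> set lam" using that by simp
    then show ?thesis using assms unfolding is_partition_def by (metis gr0I)
  qed
  then show ?thesis by (simp add: row_len_young)
qed

lemma young_inj:
  assumes "is_partition lam" "is_partition mu" "young lam = young mu"
  shows "lam = mu"
proof (rule nth_equalityI)
  have "{1..length lam} = {1..length mu}"
    using row_len_young_pos_iff[OF assms(1)] row_len_young_pos_iff[OF assms(2)] assms(3)
    by (simp add: set_eq_iff)
  then show len: "length lam = length mu" by (metis card_atLeastAtMost diff_Suc_1)
  show "lam ! k = mu ! k" if "k < length lam" for k
    using row_len_young[of lam "Suc k"] row_len_young[of mu "Suc k"] that len assms(3) by simp
qed

lemma ex_partition_of_diagram:
  assumes S: "diagram S"
  obtains lam where "is_partition lam" "young lam = S"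
proof -
  define n where "n = row_len (prod.swap ` S) 1"
  have pos: "0 < row_len S i \<longleftrightarrow> i \<le> n" if "1 \<le> i" for i
  proof -
    have "(i, 1) \<in> S \<longleftrightarrow> (1, i) \<in> prod.swap ` S" by (simp add: mem_swap_image)
    then show ?thesis
      using that mem_diagram_iff[OF S, of i 1] mem_diagram_iff[OF diagram_swap[OF S], of 1 i]
      by (auto simp: n_def)
  qed
  define lam where "lam = map (\<lambda>k. row_len S (Suc k)) [0..<n]"
  have "sorted_wrt (\<ge>) lam"
    using row_len_antimono[OF S] by (auto simp: sorted_wrt_iff_nth_less lam_def)
  moreover have "0 < row_len S (Suc k)" if "k < n" for k
    using pos[of "Suc k"] that by simp
  then have "0 \<notin> set lam" by (fastforce simp: lam_def)
  ultimately have "is_partition lam" by (simp add: is_partition_def)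
  moreover have "(i, j) \<in> young lam \<longleftrightarrow> (i, j) \<in> S" for i j
    using pos[of i] by (auto simp: mem_young lam_def mem_diagram_iff[OF S])
  then have "young lam = S" by auto
  ultimately show thesis by (rule that)
qed

lemma bij_betw_young: "bij_betw young {lam. is_partition lam} {S. diagram S}"
  using young_inj diagram_young
  by (intro bij_betw_imageI) (auto simp: inj_on_def elim: ex_partition_of_diagram)

subsection \<open>Standard tableaux\<close>

definition maximal_cells :: "cell set \<Rightarrow> cell set" where
  "maximal_cells D = {c \<in> D. \<forall>d\<in>D. c \<le> d \<longrightarrow> d = c}"

lemma SYT_iff:
  "T \<in> SYT D \<longleftrightarrow> T \<in> extensional D \<and> bij_betw T D {1..card D} \<and> mono_on D T"
  by (auto simp: SYT_def mono_on_def)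

lemma SYT_range: "T \<in> SYT D \<Longrightarrow> c \<in> D \<Longrightarrow> T c \<in> {1..card D}"
  unfolding SYT_iff using bij_betw_apply by metis

lemma SYT_mono: "T \<in> SYT D \<Longrightarrow> c \<in> D \<Longrightarrow> d \<in> D \<Longrightarrow> c \<le> d \<Longrightarrow> T c \<le> T d"
  unfolding SYT_iff using mono_onD by blast

lemma SYT_inj_on: "T \<in> SYT D \<Longrightarrow> inj_on T D"
  by (simp add: SYT_iff bij_betw_def)

lemma finite_SYT: "finite D \<Longrightarrow> finite (SYT D)"
proof (rule finite_subset)
  show "SYT D \<subseteq> PiE D (\<lambda>_. {1..card D})"
    using SYT_range by (auto simp: PiE_def SYT_iff)
qed (auto intro: finite_PiE)

lemma SYT_max_cell:
  assumes T: "T \<in> SYT D" and c: "c \<in> D" "T c = card D"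
  shows "c \<in> maximal_cells D"
proof -
  have "d = c" if "d \<in> D" "c \<le> d" for d
  proof -
    have "T c = T d" using SYT_mono[OF T c(1) that] SYT_range[OF T that(1)] c(2) by simp
    then show ?thesis using SYT_inj_on[OF T] c(1) that(1) by (simp add: inj_on_eq_iff)
  qed
  then show ?thesis using c(1) by (simp add: maximal_cells_def)
qed

lemma SYT_remove_max:
  assumes T: "T \<in> SYT D" and c: "c \<in> D" "T c = card D"
  shows "restrict T (D - {c}) \<in> SYT (D - {c})"
proof -
  have "bij_betw T (D - {c}) ({1..card D} - {card D})"
    using T c SYT_range[OF T c(1)] by (intro bij_betw_DiffI) (auto simp: SYT_iff)
  moreover have "{1..card D} - {card D} = {1..card (D - {c})}"
    using c(1) by (auto simp: card_Diff_singleton_if)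
  ultimately have "bij_betw (restrict T (D - {c})) (D - {c}) {1..card (D - {c})}"
    by (subst bij_betw_cong[of _ _ T]) auto
  moreover have "mono_on (D - {c}) (restrict T (D - {c}))"
    using T by (auto simp: SYT_iff mono_on_def)
  ultimately show ?thesis by (simp add: SYT_iff)
qed

lemma SYT_extend_max:
  assumes T: "T \<in> SYT (D - {c})" and c: "c \<in> maximal_cells D" and D: "finite D"
  shows "T(c := card D) \<in> SYT D"
proof -
  let ?T = "T(c := card D)"
  have cD: "c \<in> D" using c by (simp add: maximal_cells_def)
  then have card: "card D = Suc (card (D - {c}))" using D by (metis card.remove)
  have "bij_betw ?T (D - {c}) {1..card (D - {c})}"
    using T by (subst bij_betw_cong[of _ _ T]) (auto simp: SYT_iff)
  then have "bij_betw ?T (insert c (D - {c})) (insert (?T c) {1..card (D - {c})})"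
    by (rule notIn_Un_bij_betw[of c, simplified, rotated 2]) (auto simp: card)
  moreover have "insert c (D - {c}) = D" "insert (?T c) {1..card (D - {c})} = {1..card D}"
    using cD card by auto
  ultimately have "bij_betw ?T D {1..card D}" by simp
  moreover have "mono_on D ?T"
  proof (rule mono_onI)
    show "?T a \<le> ?T b" if "a \<in> D" "b \<in> D" "a \<le> b" for a b
    proof (cases "a = c")
      case True
      then have "b = c" using that c by (simp add: maximal_cells_def)
      then show ?thesis using True by simp
    next
      case False
      then show ?thesis using that SYT_mono[OF T, of a b] SYT_range[OF T, of a] card by simp
    qed
  qed
  moreover have "?T \<in> extensional D" using T cD by (auto simp: SYT_iff extensional_def)
  ultimately show ?thesis by (simp add: SYT_iff)
qed

lemma SYT_nonempty:
  assumes "finite D" shows "SYT D \<noteq> {}"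
  using assms
proof (induction "card D" arbitrary: D)
  case 0
  then show ?case by (auto simp: SYT_iff bij_betw_def)
next
  case (Suc n)
  then have "D \<noteq> {}" by auto
  then obtain c where c: "c \<in> maximal_cells D"
    using finite_has_maximal[OF Suc.prems] by (auto simp: maximal_cells_def)
  then have "c \<in> D" by (simp add: maximal_cells_def)
  then obtain T where "T \<in> SYT (D - {c})" using Suc.hyps Suc.prems by fastforce
  then show ?case using SYT_extend_max[OF _ c Suc.prems] by blast
qed

lemma bij_betw_SYT_extend_max:
  assumes c: "c \<in> maximal_cells D" and D: "finite D"
  shows "bij_betw (\<lambda>T. T(c := card D)) (SYT (D - {c})) {T \<in> SYT D. T c = card D}"
proof (rule bij_betw_byWitness[where f' = "\<lambda>T. restrict T (D - {c})"])
  have cD: "c \<in> D" using c by (simp add: maximal_cells_def)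
  show "\<forall>T\<in>SYT (D - {c}). restrict (T(c := card D)) (D - {c}) = T"
    by (auto simp: SYT_iff extensional_def fun_eq_iff)
  show "\<forall>T\<in>{T \<in> SYT D. T c = card D}. (restrict T (D - {c}))(c := card D) = T"
    by (auto simp: SYT_iff extensional_def fun_eq_iff)
  show "(\<lambda>T. T(c := card D)) ` SYT (D - {c}) \<subseteq> {T \<in> SYT D. T c = card D}"
    using SYT_extend_max[OF _ c D] by auto
  show "(\<lambda>T. restrict T (D - {c})) ` {T \<in> SYT D. T c = card D} \<subseteq> SYT (D - {c})"
    using SYT_remove_max[OF _ cD] by auto
qed

lemma sum_SYT_by_max_cell:
  fixes g :: "(cell \<Rightarrow> nat) \<Rightarrow> 'b::comm_monoid_add"
  assumes D: "finite D" "D \<noteq> {}"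
  shows "(\<Sum>T\<in>SYT D. g T) = (\<Sum>c\<in>maximal_cells D. \<Sum>T\<in>SYT (D - {c}). g (T(c := card D)))"
proof -
  have "(\<Sum>c | c \<in> maximal_cells D \<and> T c = card D. g T) = g T" if T: "T \<in> SYT D" for T
  proof -
    have "card D \<in> {1..card D}" using D by (simp add: card_gt_0_iff Suc_le_eq)
    then have "card D \<in> T ` D" using T by (simp add: SYT_iff bij_betw_def)
    then obtain c where c: "c \<in> D" "T c = card D" by force
    have "d = c" if "d \<in> maximal_cells D" "T d = card D" for d
      using that c inj_onD[OF SYT_inj_on[OF T], of d c] by (simp add: maximal_cells_def)
    then have "{d. d \<in> maximal_cells D \<and> T d = card D} = {c}"
      using SYT_max_cell[OF T c] c(2) by blast
    then show ?thesis by simp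
  qed
  then have "(\<Sum>T\<in>SYT D. g T) = (\<Sum>T\<in>SYT D. \<Sum>c | c \<in> maximal_cells D \<and> T c = card D. g T)"
    by simp
  also have "\<dots> = (\<Sum>c\<in>maximal_cells D. \<Sum>T | T \<in> SYT D \<and> T c = card D. g T)"
    using D(1) by (intro sum.swap_restrict finite_SYT) (simp_all add: maximal_cells_def)
  also have "\<dots> = (\<Sum>c\<in>maximal_cells D. \<Sum>T\<in>SYT (D - {c}). g (T(c := card D)))"
    by (intro sum.cong refl sum.reindex_bij_betw[symmetric] bij_betw_SYT_extend_max D(1))
  finally show ?thesis .
qed

lemma maximal_cells_skew:
  assumes L: "diagram L" and M: "diagram M"
  shows "maximal_cells (L - M) = removable L - M"
proof (intro set_eqI iffI)
  fix c assume "c \<in> maximal_cells (L - M)"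
  then have c: "c \<in> L" "c \<notin> M" and max: "\<And>d. d \<in> L - M \<Longrightarrow> c \<le> d \<Longrightarrow> d = c"
    by (auto simp: maximal_cells_def)
  have "diagram (L - {c})"
  proof (rule diagramI)
    show "a \<in> L - {c}" if "d \<in> L - {c}" "(1, 1) \<le> a" "a \<le> d" for a d
    proof -
      have "d \<notin> M" if "a = c"
        using diagram_downward[OF M, of d c] \<open>(1, 1) \<le> a\<close> \<open>a \<le> d\<close> c(2) that by blast
      then have "a \<noteq> c" using max[of d] that by blast
      then show ?thesis using diagram_downward[OF L, of d a] that by blast
    qed
  qed (use L in \<open>auto dest: diagram_finite diagram_pos\<close>)
  then show "c \<in> removable L - M" using c L by (simp add: removable_def)
next
  fix c assume c: "c \<in> removable L - M"
  have "d = c" if "d \<in> L - M" "c \<le> d" for d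
  proof (rule ccontr)
    assume "d \<noteq> c"
    then have "c \<in> L - {c}"
      using c that diagram_pos[OF L] diagram_downward[of "L - {c}" d c]
      by (simp add: removable_def)
    then show False by simp
  qed
  then show "c \<in> maximal_cells (L - M)" using c by (simp add: maximal_cells_def removable_def)
qed

subsection \<open>Recursions for the sign imbalance\<close>

definition insertion_sign :: "cell set \<Rightarrow> cell \<Rightarrow> int" where
  "insertion_sign S c = (- 1) ^ card {b \<in> S. c \<lhd> b}"

lemma cell_less_irrefl: "\<not> c \<lhd> c"
  by (simp add: cell_less_def)

lemma cell_less_iff_not_greater: "c \<noteq> d \<Longrightarrow> c \<lhd> d \<longleftrightarrow> \<not> d \<lhd> c"
  by (auto simp: cell_less_def prod_eq_iff)

lemma insertion_sign_insert:
  assumes "finite S" "a \<notin> S"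
  shows "insertion_sign (insert a S) c =
    (if c \<lhd> a then - insertion_sign S c else insertion_sign S c)"
proof -
  have "{b \<in> insert a S. c \<lhd> b} = (if c \<lhd> a then insert a {b \<in> S. c \<lhd> b} else {b \<in> S. c \<lhd> b})"
    by auto
  then show ?thesis using assms by (simp add: insertion_sign_def)
qed

lemma insertion_sign_square: "insertion_sign S c * insertion_sign S c = 1"
  by (simp add: insertion_sign_def flip: power_mult_distrib)

lemma insertion_sign_commute:
  assumes "finite S" "c \<notin> S" "d \<notin> S" "c \<noteq> d"
  shows "insertion_sign (insert c S) d * insertion_sign S c =
    - (insertion_sign (insert d S) c * insertion_sign S d)"
  using assms cell_less_iff_not_greater[of c d] by (auto simp: insertion_sign_insert)

lemma insertion_sign_exchange:
  assumes "finite S" "c \<notin> S" "d \<notin> S" "c \<noteq> d"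
  shows "insertion_sign (insert d S) c * insertion_sign (insert c S) d =
    - (insertion_sign S c * insertion_sign S d)"
  using assms cell_less_iff_not_greater[of c d] by (auto simp: insertion_sign_insert)

definition skew_inversions :: "cell set \<Rightarrow> cell set \<Rightarrow> (cell \<Rightarrow> nat) \<Rightarrow> (cell \<times> cell) set" where
  "skew_inversions L M T = {(a, b). a \<in> L - M \<and> b \<in> L - M \<and> a \<lhd> b \<and> T a > T b} \<union>
      {(a, b). a \<in> L - M \<and> b \<in> M \<and> a \<lhd> b}"

definition imbalance :: "cell set \<Rightarrow> cell set \<Rightarrow> int" where
  "imbalance L M = (\<Sum>T\<in>SYT (L - M). (- 1) ^ card (skew_inversions L M T))"

lemma sign_imbalance_eq_imbalance:
  assumes sub: "young mu \<subseteq> young lam"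
  shows "sign_imbalance lam mu = imbalance (young lam) (young mu)"
proof -
  obtain T0 where T0: "T0 \<in> SYT (young mu)"
    using SYT_nonempty[OF finite_young] by blast
  show ?thesis
    unfolding sign_imbalance_def imbalance_def skew_inversions_def skew_def
    using skew_sign_independent[OF sub T0] straight_sign_diamond[OF sub T0]
    by (intro sum.cong refl) (simp add: skew_def)
qed

lemma skew_inversions_extend_max:
  assumes c: "c \<in> L - M" and sub: "M \<subseteq> L" and less: "\<And>a. a \<in> L - M - {c} \<Longrightarrow> T a < n"
  shows "skew_inversions L M (T(c := n)) =
    skew_inversions (L - {c}) M T \<union> Pair c ` {b \<in> L - {c}. c \<lhd> b}"
proof (rule set_eqI, clarify)
  fix a b
  show "(a, b) \<in> skew_inversions L M (T(c := n)) \<longleftrightarrow>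
      (a, b) \<in> skew_inversions (L - {c}) M T \<union> Pair c ` {b \<in> L - {c}. c \<lhd> b}"
  proof (cases "a = c")
    case True
    then show ?thesis
      using c sub less[of b] cell_less_irrefl[of c] unfolding skew_inversions_def by auto
  next
    case False
    then show ?thesis using c less[of a] unfolding skew_inversions_def by auto
  qed
qed

lemma sign_extend_max:
  assumes c: "c \<in> L - M" and sub: "M \<subseteq> L" and fin: "finite L" and T: "T \<in> SYT (L - M - {c})"
  shows "(- 1 :: int) ^ card (skew_inversions L M (T(c := card (L - M)))) =
    insertion_sign (L - {c}) c * (- 1) ^ card (skew_inversions (L - {c}) M T)"
proof -
  have "card (L - M) = Suc (card (L - M - {c}))" using fin c by (metis card.remove finite_Diff)
  then have "T a < card (L - M)" if "a \<in> L - M - {c}" for a using SYT_range[OF T that] by simp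
  then have inv: "skew_inversions L M (T(c := card (L - M))) =
      skew_inversions (L - {c}) M T \<union> Pair c ` {b \<in> L - {c}. c \<lhd> b}"
    by (rule skew_inversions_extend_max[OF c sub])
  have "finite (skew_inversions (L - {c}) M T)"
    by (rule finite_subset[of _ "L \<times> L"]) (use fin sub in \<open>auto simp: skew_inversions_def\<close>)
  moreover have "skew_inversions (L - {c}) M T \<inter> Pair c ` {b \<in> L - {c}. c \<lhd> b} = {}"
    unfolding skew_inversions_def by blast
  ultimately have "card (skew_inversions L M (T(c := card (L - M)))) =
      card (skew_inversions (L - {c}) M T) + card (Pair c ` {b \<in> L - {c}. c \<lhd> b})"
    unfolding inv using fin by (intro card_Un_disjoint) auto
  then show ?thesis by (simp add: insertion_sign_def power_add card_image inj_on_def)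
qed

lemma imbalance_self: "imbalance L L = 1"
proof -
  have "SYT {} = {\<lambda>_. undefined}" by (auto simp: SYT_iff bij_betw_def)
  then show ?thesis by (simp add: imbalance_def skew_inversions_def)
qed

lemma imbalance_remove_max:
  assumes L: "diagram L" and M: "diagram M" and sub: "M \<subset> L"
  shows "imbalance L M =
    (\<Sum>c\<in>removable L - M. insertion_sign (L - {c}) c * imbalance (L - {c}) M)"
proof -
  have fin: "finite L" using L by (rule diagram_finite)
  have "imbalance L M = (\<Sum>c\<in>removable L - M. \<Sum>T\<in>SYT (L - M - {c}).
      (- 1) ^ card (skew_inversions L M (T(c := card (L - M)))))"
    unfolding imbalance_def maximal_cells_skew[OF L M, symmetric]
    using fin sub by (intro sum_SYT_by_max_cell) auto
  also have "\<dots> = (\<Sum>c\<in>removable L - M. \<Sum>T\<in>SYT (L - M - {c}).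
      insertion_sign (L - {c}) c * (- 1) ^ card (skew_inversions (L - {c}) M T))"
    using sub fin by (intro sum.cong refl sign_extend_max) (auto simp: removable_def)
  also have "\<dots> = (\<Sum>c\<in>removable L - M. insertion_sign (L - {c}) c * imbalance (L - {c}) M)"
    unfolding imbalance_def sum_distrib_left
      Diff_insert2[of L _ M, symmetric] Diff_insert[of L _ M, symmetric] ..
  finally show ?thesis .
qed

lemma imbalance_insert:
  assumes c: "c \<in> addable M"
  shows "imbalance (insert c M) M = insertion_sign M c"
proof -
  have M: "diagram M" "c \<notin> M" "diagram (insert c M)" using c by (auto simp: addable_def)
  then have "removable (insert c M) - M = {c}" "insert c M - {c} = M"
    by (auto simp: removable_def)
  then show ?thesis
    using M by (subst imbalance_remove_max) (auto simp: imbalance_self)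
qed

lemma imbalance_remove_min:
  assumes "diagram L" and M: "diagram M" and "M \<subset> L"
  shows "imbalance L M = (\<Sum>d\<in>addable M \<inter> L. insertion_sign M d * imbalance L (insert d M))"
  using assms(1,3)
proof (induction "card L" arbitrary: L rule: less_induct)
  case less
  note L = less.prems(1)
  show ?case
  proof (cases "\<exists>c. L = insert c M")
    case True
    then obtain c where c: "L = insert c M" "c \<notin> M" using less.prems(2) by blast
    then have corner: "c \<in> addable M" using L M by (simp add: addable_def)
    then have "addable M \<inter> L = {c}" using c by (auto simp: addable_def)
    then show ?thesis by (simp only: c(1) imbalance_insert[OF corner]) (simp add: imbalance_self)
  next
    case False
    have fin: "finite L" using L by (rule diagram_finite)
    have remove_min: "imbalance (L - {c}) M =
        (\<Sum>d\<in>addable M \<inter> (L - {c}). insertion_sign M d * imbalance (L - {c}) (insert d M))"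
      if "c \<in> removable L - M" for c
      using that False less.prems(2) fin
      by (intro less.hyps card_Diff1_less) (auto simp: removable_def)
    have remove_max: "imbalance L (insert d M) = (\<Sum>c\<in>removable L - insert d M.
        insertion_sign (L - {c}) c * imbalance (L - {c}) (insert d M))"
      if "d \<in> addable M \<inter> L" for d
      using that False less.prems(2) by (intro imbalance_remove_max[OF L]) (auto simp: addable_def)
    have "imbalance L M = (\<Sum>c\<in>removable L - M. \<Sum>d | d \<in> addable M \<inter> L \<and> d \<noteq> c.
        insertion_sign (L - {c}) c * (insertion_sign M d * imbalance (L - {c}) (insert d M)))"
      unfolding imbalance_remove_max[OF L M less.prems(2)]
      by (intro sum.cong refl) (auto simp: remove_min sum_distrib_left intro!: sum.cong)
    also have "\<dots> = (\<Sum>d\<in>addable M \<inter> L. \<Sum>c | c \<in> removable L - M \<and> d \<noteq> c.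
        insertion_sign (L - {c}) c * (insertion_sign M d * imbalance (L - {c}) (insert d M)))"
      by (intro sum.swap_restrict finite_Diff finite_Int finite_removable disjI1 finite_addable)
    also have "\<dots> = (\<Sum>d\<in>addable M \<inter> L. insertion_sign M d * imbalance L (insert d M))"
      by (intro sum.cong refl) (auto simp: remove_max sum_distrib_left intro!: sum.cong)
    finally show ?thesis .
  qed
qed

subsection \<open>The signed up and down operators\<close>

definition signed_wt :: "(cell \<Rightarrow> 'a::comm_ring_1) \<Rightarrow> cell set \<Rightarrow> cell \<Rightarrow> 'a" where
  "signed_wt w S c = of_int (insertion_sign S c) * w c"

definition up_op :: "(cell \<Rightarrow> 'a::comm_ring_1) \<Rightarrow> (cell set \<Rightarrow> 'a) \<Rightarrow> cell set \<Rightarrow> 'a" where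
  "up_op w f S = (\<Sum>c\<in>addable S. signed_wt w S c * f (insert c S))"

definition down_op :: "(cell \<Rightarrow> 'a::comm_ring_1) \<Rightarrow> (cell set \<Rightarrow> 'a) \<Rightarrow> cell set \<Rightarrow> 'a" where
  "down_op w f S = (\<Sum>c\<in>removable S. signed_wt w (S - {c}) c * f (S - {c}))"

lemma up_op_linear:
  "up_op w (\<lambda>S. a * f S + b * g S) = (\<lambda>S. a * up_op w f S + b * up_op w g S)"
  by (simp add: fun_eq_iff up_op_def distrib_left sum.distrib sum_distrib_left mult_ac)

lemma down_op_linear:
  "down_op w (\<lambda>S. a * f S + b * g S) = (\<lambda>S. a * down_op w f S + b * down_op w g S)"
  by (simp add: fun_eq_iff down_op_def distrib_left sum.distrib sum_distrib_left mult_ac)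

lemma up_op_restrict_diagrams: "up_op w (\<lambda>S. of_bool (diagram S) * f S) = up_op w f"
  by (simp add: fun_eq_iff up_op_def addable_def)

lemma up_op_eq_0: "\<not> diagram S \<Longrightarrow> up_op w f S = 0"
  by (simp add: up_op_def addable_def)

lemma signed_wt_same: "signed_wt w S c * signed_wt w' S c = w c * w' c"
proof -
  have "signed_wt w S c * signed_wt w' S c =
      of_int (insertion_sign S c * insertion_sign S c) * (w c * w' c)"
    by (simp add: signed_wt_def mult_ac)
  then show ?thesis by (simp add: insertion_sign_square)
qed

lemma signed_wt_exchange:
  assumes "finite S" "c \<notin> S" "d \<notin> S" "c \<noteq> d"
  shows "signed_wt w (insert d S) c * signed_wt w' (insert c S) d =
    - (signed_wt w S c * signed_wt w' S d)"
proof -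
  have "signed_wt w (insert d S) c * signed_wt w' (insert c S) d =
      of_int (insertion_sign (insert d S) c * insertion_sign (insert c S) d) * (w c * w' d)"
    by (simp add: signed_wt_def mult_ac)
  then show ?thesis unfolding insertion_sign_exchange[OF assms] by (simp add: signed_wt_def mult_ac)
qed

lemma removable_insert:
  assumes c: "c \<in> addable S"
  shows "removable (insert c S) = insert c {d \<in> removable S. diagram (insert c S - {d})}"
proof -
  have S: "c \<notin> S" "diagram S" "diagram (insert c S)" using c by (auto simp: addable_def)
  have "diagram (S - {d})" if "d \<in> S" "diagram (insert c S - {d})" for d
  proof -
    have "S \<inter> (insert c S - {d}) = S - {d}" using S(1) by blast
    then show ?thesis using diagram_Int[OF S(2) that(2)] by simp
  qed
  then show ?thesis using S by (auto simp: removable_def)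
qed

lemma addable_remove:
  assumes d: "d \<in> removable S"
  shows "addable (S - {d}) = insert d {c \<in> addable S. diagram (insert c S - {d})}"
proof -
  have S: "d \<in> S" "diagram S" "diagram (S - {d})" using d by (auto simp: removable_def)
  have "diagram (insert c S)" if "diagram (insert c S - {d})" for c
  proof -
    have "S \<union> (insert c S - {d}) = insert c S" using S(1) by blast
    then show ?thesis using diagram_Un[OF S(2) that] by simp
  qed
  moreover have "insert c (S - {d}) = (if c = d then S else insert c S - {d})" for c
    using S(1) by auto
  ultimately show ?thesis using S by (auto simp: addable_def)
qed

definition exchange_term ::
  "(cell \<Rightarrow> 'a::comm_ring_1) \<Rightarrow> (cell \<Rightarrow> 'a) \<Rightarrow> (cell set \<Rightarrow> 'a) \<Rightarrow> cell set \<Rightarrow> cell \<Rightarrow> cell \<Rightarrow> 'a"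
where
  "exchange_term w w' f S c d =
     signed_wt w S c * (signed_wt w' (insert c S - {d}) d * f (insert c S - {d}))"

definition exchange_sum ::
  "(cell \<Rightarrow> 'a::comm_ring_1) \<Rightarrow> (cell \<Rightarrow> 'a) \<Rightarrow> (cell set \<Rightarrow> 'a) \<Rightarrow> cell set \<Rightarrow> 'a" where
  "exchange_sum w w' f S =
     (\<Sum>c\<in>addable S. \<Sum>d | d \<in> removable S \<and> diagram (insert c S - {d}). exchange_term w w' f S c d)"

lemma exchange_term_remove_first:
  assumes c: "c \<in> addable S" and d: "d \<in> removable S"
  shows "signed_wt w' (S - {d}) d * (signed_wt w (S - {d}) c * f (insert c (S - {d}))) =
    - exchange_term w w' f S c d"
proof -
  define P where "P = S - {d}"
  have "c \<notin> S" "d \<in> S" "finite S" using c d by (auto simp: addable_def removable_def diagram_finite)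
  then have S: "S = insert d P" "insert c S - {d} = insert c P"
    and P: "finite P" "c \<notin> P" "d \<notin> P" "c \<noteq> d"
    by (auto simp: P_def)
  have "signed_wt w S c * signed_wt w' (insert c P) d = - (signed_wt w P c * signed_wt w' P d)"
    using signed_wt_exchange[OF P] S(1) by simp
  then have "signed_wt w' P d * signed_wt w P c = - (signed_wt w S c * signed_wt w' (insert c P) d)"
    by (simp add: mult.commute)
  then show ?thesis
    unfolding exchange_term_def S(2) P_def[symmetric] mult.assoc[symmetric] by simp
qed

lemma up_down_eq:
  "up_op w (down_op w' f) S = (\<Sum>c\<in>addable S. w c * w' c) * f S + exchange_sum w w' f S"
proof -
  have "signed_wt w S c * down_op w' f (insert c S) = w c * w' c * f S +
      (\<Sum>d | d \<in> removable S \<and> diagram (insert c S - {d}). exchange_term w w' f S c d)"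
    if c: "c \<in> addable S" for c
  proof -
    have "c \<notin> S" using c by (simp add: addable_def)
    then have "c \<notin> removable S" by (simp add: removable_def)
    have "signed_wt w S c * down_op w' f (insert c S) =
        (\<Sum>d\<in>removable (insert c S). exchange_term w w' f S c d)"
      by (simp only: down_op_def sum_distrib_left exchange_term_def)
    also have "\<dots> = exchange_term w w' f S c c +
        (\<Sum>d | d \<in> removable S \<and> diagram (insert c S - {d}). exchange_term w w' f S c d)"
      unfolding removable_insert[OF c] using \<open>c \<notin> removable S\<close>
      by (intro sum.insert) (simp_all add: finite_removable)
    also have "exchange_term w w' f S c c = w c * w' c * f S"
      using \<open>c \<notin> S\<close> by (simp add: exchange_term_def signed_wt_same flip: mult.assoc)
    finally show ?thesis .
  qed
  then show ?thesis
    by (simp add: up_op_def exchange_sum_def sum.distrib sum_distrib_right)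
qed

lemma down_up_eq:
  "down_op w' (up_op w f) S = (\<Sum>c\<in>removable S. w c * w' c) * f S - exchange_sum w w' f S"
proof -
  have "signed_wt w' (S - {d}) d * up_op w f (S - {d}) = w d * w' d * f S -
      (\<Sum>c | c \<in> addable S \<and> diagram (insert c S - {d}). exchange_term w w' f S c d)"
    if d: "d \<in> removable S" for d
  proof -
    let ?g = "\<lambda>c. signed_wt w' (S - {d}) d * (signed_wt w (S - {d}) c * f (insert c (S - {d})))"
    have "d \<in> S" using d by (simp add: removable_def)
    then have "d \<notin> addable S" by (simp add: addable_def)
    have "signed_wt w' (S - {d}) d * up_op w f (S - {d}) = (\<Sum>c\<in>addable (S - {d}). ?g c)"
      by (simp only: up_op_def sum_distrib_left)
    also have "\<dots> = ?g d + (\<Sum>c | c \<in> addable S \<and> diagram (insert c S - {d}). ?g c)"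
      unfolding addable_remove[OF d] using \<open>d \<notin> addable S\<close>
      by (intro sum.insert) (simp_all add: finite_addable)
    also have "?g d = w d * w' d * f S"
      by (simp only: insert_Diff[OF \<open>d \<in> S\<close>] mult.assoc[symmetric] signed_wt_same
          mult.commute[of "w' d" "w d"])
    also have "(\<Sum>c | c \<in> addable S \<and> diagram (insert c S - {d}). ?g c) =
        - (\<Sum>c | c \<in> addable S \<and> diagram (insert c S - {d}). exchange_term w w' f S c d)"
      unfolding sum_negf[symmetric] by (intro sum.cong refl exchange_term_remove_first d) simp
    finally show ?thesis by simp
  qed
  then have "down_op w' (up_op w f) S = (\<Sum>d\<in>removable S. w d * w' d * f S) -
      (\<Sum>d\<in>removable S. \<Sum>c | c \<in> addable S \<and> diagram (insert c S - {d}). exchange_term w w' f S c d)"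
    by (simp add: down_op_def sum_subtractf)
  then show ?thesis
    unfolding exchange_sum_def sum_distrib_right
    by (subst sum.swap_restrict[OF finite_addable finite_removable])
qed

lemma up_down_anticommute:
  assumes weights: "\<And>c. w c * w' c = (- 1) ^ Suc (fst c)"
  shows "up_op w (down_op w' f) S + down_op w' (up_op w f) S = of_bool (diagram S) * f S"
proof (cases "diagram S")
  case True
  have "up_op w (down_op w' f) S + down_op w' (up_op w f) S =
      ((\<Sum>c\<in>addable S. w c * w' c) + (\<Sum>c\<in>removable S. w c * w' c)) * f S"
    by (simp add: up_down_eq down_up_eq distrib_right)
  also have "(\<Sum>c\<in>addable S. w c * w' c) = 1 - (\<Sum>c\<in>removable S. w c * w' c)"
    using sum_addable[OF True, of "\<lambda>i. (- 1) ^ Suc i :: 'a"] by (simp add: weights sum_negf)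
  finally show ?thesis using True by simp
next
  case False
  then show ?thesis by (simp add: up_op_eq_0 down_op_def removable_def)
qed

lemma up_up_down_commute:
  assumes weights: "\<And>c. w c * w' c = (- 1) ^ Suc (fst c)"
  shows "up_op w (up_op w (down_op w' f)) = down_op w' (up_op w (up_op w f))"
proof -
  have up_down: "up_op w (down_op w' g) =
      (\<lambda>S. 1 * (of_bool (diagram S) * g S) + (- 1) * down_op w' (up_op w g) S)" for g
    using up_down_anticommute[of w w' g, OF weights] by (simp add: fun_eq_iff algebra_simps)
  have "up_op w (up_op w (down_op w' f)) =
      (\<lambda>S. up_op w f S - up_op w (down_op w' (up_op w f)) S)"
    by (subst up_down, subst up_op_linear) (simp add: up_op_restrict_diagrams)
  also have "\<dots> = down_op w' (up_op w (up_op w f))"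
    by (subst up_down) (auto simp: fun_eq_iff up_op_eq_0)
  finally show ?thesis .
qed

subsection \<open>Sums over larger and smaller diagrams\<close>

definition diagrams_above :: "nat \<Rightarrow> cell set \<Rightarrow> cell set set" where
  "diagrams_above m M = {L. diagram L \<and> M \<subseteq> L \<and> card (L - M) = m}"

definition diagrams_below :: "nat \<Rightarrow> cell set \<Rightarrow> cell set set" where
  "diagrams_below m L = {M. diagram M \<and> M \<subseteq> L \<and> card (L - M) = m}"

definition weighted_imbalance :: "(cell \<Rightarrow> 'a::comm_ring_1) \<Rightarrow> cell set \<Rightarrow> cell set \<Rightarrow> 'a" where
  "weighted_imbalance w L M = prod w (L - M) * of_int (imbalance L M)"

definition sum_above :: "(cell \<Rightarrow> 'a::comm_ring_1) \<Rightarrow> nat \<Rightarrow> cell set \<Rightarrow> 'a" where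
  "sum_above w m M = (\<Sum>L\<in>diagrams_above m M. weighted_imbalance w L M)"

definition sum_below :: "(cell \<Rightarrow> 'a::comm_ring_1) \<Rightarrow> nat \<Rightarrow> cell set \<Rightarrow> 'a" where
  "sum_below w m L = (\<Sum>M\<in>diagrams_below m L. weighted_imbalance w L M)"

lemma finite_diagrams_above:
  assumes "finite M" shows "finite (diagrams_above m M)"
proof (rule finite_subset)
  show "diagrams_above m M \<subseteq> Pow ({..card M + m} \<times> {..card M + m})"
  proof
    fix L assume "L \<in> diagrams_above m M"
    then have L: "diagram L" "M \<subseteq> L" "card (L - M) = m" by (auto simp: diagrams_above_def)
    then have "card L = card M + m"
      using card_Diff_subset[OF assms L(2)] card_mono[OF diagram_finite[OF L(1)] L(2)] by simp
    then show "L \<in> Pow ({..card M + m} \<times> {..card M + m})"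
      using diagram_subset_square[OF L(1)] by simp
  qed
qed simp

lemma finite_diagrams_below: "finite L \<Longrightarrow> finite (diagrams_below m L)"
  by (rule finite_subset[of _ "Pow L"]) (auto simp: diagrams_below_def)

lemma diagrams_above_0: "diagram M \<Longrightarrow> diagrams_above 0 M = {M}"
  by (auto simp: diagrams_above_def dest: diagram_finite)

lemma diagrams_below_0: "diagram L \<Longrightarrow> diagrams_below 0 L = {L}"
  by (auto simp: diagrams_below_def dest: diagram_finite)

lemma diagrams_above_insert:
  assumes "c \<notin> M"
  shows "diagrams_above m (insert c M) = {L. L \<in> diagrams_above (Suc m) M \<and> c \<in> L}"
proof -
  have "card (L - M) = Suc (card (L - insert c M))" if "diagram L" "c \<in> L" for L
    using card.remove[of "L - M" c] assms that by (simp add: diagram_finite flip: Diff_insert)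
  then show ?thesis by (auto simp: diagrams_above_def)
qed

lemma diagrams_below_remove:
  assumes "finite L" "c \<in> L"
  shows "diagrams_below m (L - {c}) = {M. M \<in> diagrams_below (Suc m) L \<and> c \<notin> M}"
proof -
  have "card (L - M) = Suc (card (L - {c} - M))" if "c \<notin> M" for M
    using card.remove[of "L - M" c] assms that by (simp add: flip: Diff_insert Diff_insert2)
  then show ?thesis using assms by (auto simp: diagrams_below_def)
qed

lemma weighted_imbalance_remove_max:
  assumes L: "diagram L" and M: "diagram M" and sub: "M \<subset> L"
  shows "weighted_imbalance w L M =
    (\<Sum>c | c \<in> removable L \<and> c \<notin> M. signed_wt w (L - {c}) c * weighted_imbalance w (L - {c}) M)"
proof -
  have "prod w (L - M) = w c * prod w (L - {c} - M)" if "c \<in> L - M" for c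
    using prod.remove[OF _ that, of w] diagram_finite[OF L]
    by (simp flip: Diff_insert Diff_insert2)
  then show ?thesis
    unfolding weighted_imbalance_def imbalance_remove_max[OF assms] of_int_sum sum_distrib_left
    by (intro sum.cong) (auto simp: removable_def signed_wt_def)
qed

lemma weighted_imbalance_remove_min:
  assumes L: "diagram L" and M: "diagram M" and sub: "M \<subset> L"
  shows "weighted_imbalance w L M =
    (\<Sum>c | c \<in> addable M \<and> c \<in> L. signed_wt w M c * weighted_imbalance w L (insert c M))"
proof -
  have "prod w (L - M) = w c * prod w (L - insert c M)" if "c \<in> L - M" for c
    using prod.remove[OF _ that, of w] diagram_finite[OF L] by (simp flip: Diff_insert)
  then show ?thesis
    unfolding weighted_imbalance_def imbalance_remove_min[OF assms] of_int_sum sum_distrib_left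
    by (intro sum.cong) (auto simp: addable_def signed_wt_def)
qed

lemma sum_above_Suc:
  assumes M: "diagram M"
  shows "sum_above w (Suc m) M = up_op w (sum_above w m) M"
proof -
  let ?X = "diagrams_above (Suc m) M"
  have "sum_above w (Suc m) M =
      (\<Sum>L\<in>?X. \<Sum>c | c \<in> addable M \<and> c \<in> L. signed_wt w M c * weighted_imbalance w L (insert c M))"
    unfolding sum_above_def
    by (intro sum.cong refl weighted_imbalance_remove_min M) (auto simp: diagrams_above_def)
  also have "\<dots> =
      (\<Sum>c\<in>addable M. \<Sum>L | L \<in> ?X \<and> c \<in> L. signed_wt w M c * weighted_imbalance w L (insert c M))"
    using diagram_finite[OF M] by (intro sum.swap_restrict finite_diagrams_above finite_addable)
  also have "\<dots> = up_op w (sum_above w m) M"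
    unfolding up_op_def sum_above_def sum_distrib_left
    by (intro sum.cong refl) (simp_all add: diagrams_above_insert addable_def)
  finally show ?thesis .
qed

lemma sum_below_Suc:
  assumes L: "diagram L"
  shows "sum_below w (Suc m) L = down_op w (sum_below w m) L"
proof -
  let ?X = "diagrams_below (Suc m) L"
  let ?g = "\<lambda>c M. signed_wt w (L - {c}) c * weighted_imbalance w (L - {c}) M"
  have fin: "finite L" using L by (rule diagram_finite)
  have "sum_below w (Suc m) L = (\<Sum>M\<in>?X. \<Sum>c | c \<in> removable L \<and> c \<notin> M. ?g c M)"
    unfolding sum_below_def
    by (intro sum.cong refl weighted_imbalance_remove_max L) (auto simp: diagrams_below_def)
  also have "\<dots> = (\<Sum>c\<in>removable L. \<Sum>M | M \<in> ?X \<and> c \<notin> M. ?g c M)"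
    using fin by (intro sum.swap_restrict finite_diagrams_below finite_removable)
  also have "\<dots> = down_op w (sum_below w m) L"
    unfolding down_op_def sum_below_def sum_distrib_left
    by (intro sum.cong refl) (simp_all add: diagrams_below_remove[OF fin] removable_def)
  finally show ?thesis .
qed

definition diagram_indicator :: "cell set \<Rightarrow> 'a::comm_ring_1" where
  "diagram_indicator S = of_bool (diagram S)"

lemma sum_above_eq_funpow:
  "diagram M \<Longrightarrow> sum_above w m M = (up_op w ^^ m) diagram_indicator M"
proof (induction m arbitrary: M)
  case 0
  then show ?case
    by (simp add: sum_above_def diagrams_above_0 weighted_imbalance_def imbalance_self
        diagram_indicator_def)
next
  case (Suc m)
  then show ?case
    unfolding sum_above_Suc[OF Suc.prems] by (auto simp: up_op_def addable_def intro!: sum.cong)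
qed

lemma sum_below_eq_funpow:
  "diagram L \<Longrightarrow> sum_below w m L = (down_op w ^^ m) diagram_indicator L"
proof (induction m arbitrary: L)
  case 0
  then show ?case
    by (simp add: sum_below_def diagrams_below_0 weighted_imbalance_def imbalance_self
        diagram_indicator_def)
next
  case (Suc m)
  then show ?case
    unfolding sum_below_Suc[OF Suc.prems] by (auto simp: down_op_def removable_def intro!: sum.cong)
qed

subsection \<open>Dominoes\<close>

lemma row_strip_2: "row_strip 2 (i, j) = {(i, j), (i, Suc j)}"
  by (auto simp: row_strip_def)

lemma column_strip_2: "column_strip 2 (i, j) = {(i, j), (Suc i, j)}"
  by (auto simp: column_strip_def)

lemma imbalance_insert_insert:
  assumes c: "c \<in> addable M" and d: "d \<in> addable (insert c M)"
  shows "imbalance (insert d (insert c M)) M =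
    (if d \<in> addable M then 0 else insertion_sign (insert c M) d * insertion_sign M c)"
proof -
  let ?L = "insert d (insert c M)"
  have diagrams: "diagram M" "diagram (insert c M)" "diagram ?L"
    and notin: "c \<notin> M" "d \<notin> M" "c \<noteq> d"
    using c d by (auto simp: addable_def)
  have diff: "?L - {d} = insert c M" "?L - {c} = insert d M" using notin by auto
  have removable: "d \<in> removable ?L" "c \<in> removable ?L \<longleftrightarrow> d \<in> addable M"
    using diagrams notin diff by (simp_all add: removable_def addable_def)
  have subset: "removable ?L \<subseteq> ?L" by (auto simp: removable_def)
  have sum: "imbalance ?L M =
      (\<Sum>e\<in>removable ?L - M. insertion_sign (?L - {e}) e * imbalance (?L - {e}) M)"
    using diagrams notin by (intro imbalance_remove_max) auto
  show ?thesis
  proof (cases "d \<in> addable M")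
    case True
    then have "removable ?L - M = {c, d}" using removable subset notin(1,2) by blast
    then have "imbalance ?L M =
        insertion_sign (insert d M) c * insertion_sign M d +
        insertion_sign (insert c M) d * insertion_sign M c"
      using notin(3) by (simp add: sum diff imbalance_insert[OF c] imbalance_insert[OF True])
    then show ?thesis
      using True insertion_sign_commute[OF diagram_finite[OF diagrams(1)] notin] by simp
  next
    case False
    then have "removable ?L - M = {d}" using removable subset notin(2) by blast
    then show ?thesis using False by (simp add: sum diff imbalance_insert[OF c])
  qed
qed

lemma imbalance_insert_ordered:
  assumes M: "diagram M" and L: "diagram (insert d (insert c M))"
    and cd: "c \<notin> M" "d \<notin> M" "c < d"
  shows "imbalance (insert d (insert c M)) M = insertion_sign (insert c M) d * insertion_sign M c"
proof -
  let ?L = "insert d (insert c M)"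
  have "?L - M = {c, d}" "?L - {d} = insert c M" using cd by auto
  moreover from this have "d \<in> maximal_cells (?L - M)" using cd by (auto simp: maximal_cells_def)
  ultimately have "diagram (insert c M)"
    using maximal_cells_skew[OF L M] by (auto simp: removable_def)
  then have "c \<in> addable M" "d \<in> addable (insert c M)"
    using M L cd by (auto simp: addable_def)
  moreover have "d \<notin> addable M"
  proof
    assume "d \<in> addable M"
    then have "c \<in> insert d M"
      using diagram_downward[of "insert d M" d c] diagram_pos[OF L, of c] cd
      by (simp add: addable_def)
    then show False using cd by simp
  qed
  ultimately show ?thesis by (simp add: imbalance_insert_insert)
qed

lemma insertion_sign_row_domino:
  assumes "(i, j) \<notin> M" "(i, Suc j) \<notin> M"
  shows "insertion_sign (insert (i, j) M) (i, Suc j) = insertion_sign M (i, j)"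
proof -
  have "{b \<in> insert (i, j) M. (i, Suc j) \<lhd> b} = {b \<in> M. (i, j) \<lhd> b}"
    using assms by (auto simp: cell_less_def intro: Suc_lessI)
  then show ?thesis by (simp add: insertion_sign_def)
qed

lemma insertion_sign_column_domino:
  assumes M: "diagram M" and L: "diagram (insert (Suc i, j) (insert (i, j) M))"
    and notin: "(i, j) \<notin> M" "(Suc i, j) \<notin> M"
  shows "insertion_sign M (i, j) = (- 1) ^ (j - 1) * insertion_sign (insert (i, j) M) (Suc i, j)"
proof -
  have pos: "1 \<le> i" "1 \<le> j" using diagram_pos_Pair[OF L, of i j] by auto
  have row: "b < j" if "(i, b) \<in> M" for b
    using notin(1) that pos mem_diagram_iff[OF M, of i] by (meson leI le_trans)
  have next_row: "(Suc i, b) \<in> M \<longleftrightarrow> 1 \<le> b \<and> b < j" for b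
  proof
    show "1 \<le> b \<and> b < j" if "(Suc i, b) \<in> M"
      using notin(2) that pos mem_diagram_iff[OF M, of "Suc i"] by (meson leI le_trans)
    show "(Suc i, b) \<in> M" if "1 \<le> b \<and> b < j"
      using diagram_downward[OF L, of "(Suc i, j)" "(Suc i, b)"] that by simp
  qed
  let ?after = "{b \<in> insert (i, j) M. (Suc i, j) \<lhd> b}"
  have "e \<in> M \<and> (i, j) \<lhd> e \<longleftrightarrow> e \<in> ?after \<union> {Suc i} \<times> {1..<j}" for e
  proof -
    consider "fst e < i" | "fst e = i" | "fst e = Suc i" | "Suc i < fst e" by linarith
    then show ?thesis
      using row[of "snd e"] next_row[of "snd e"]
      by cases (cases e; auto simp: cell_less_def)+
  qed
  then have "{b \<in> M. (i, j) \<lhd> b} = ?after \<union> {Suc i} \<times> {1..<j}" by blast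
  moreover have "?after \<inter> {Suc i} \<times> {1..<j} = {}" by (auto simp: cell_less_def)
  moreover have "finite ?after" using diagram_finite[OF M] by simp
  ultimately have "card {b \<in> M. (i, j) \<lhd> b} = card ?after + (j - 1)"
    by (simp add: card_Un_disjoint card_cartesian_product)
  then show ?thesis by (simp add: insertion_sign_def power_add)
qed

lemma imbalance_row_domino:
  assumes M: "diagram M" and L: "diagram (M \<union> row_strip 2 c)"
    and disj: "row_strip 2 c \<inter> M = {}"
  shows "imbalance (M \<union> row_strip 2 c) M = 1"
proof -
  obtain i j where c: "c = (i, j)" by (cases c)
  have "M \<union> row_strip 2 c = insert (i, Suc j) (insert (i, j) M)" by (auto simp: c row_strip_2)
  then show ?thesis
    using L disj imbalance_insert_ordered[OF M, of "(i, Suc j)" "(i, j)"]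
    by (simp add: c row_strip_2 less_prod_def insertion_sign_row_domino insertion_sign_square)
qed

lemma imbalance_column_domino:
  assumes M: "diagram M" and L: "diagram (M \<union> column_strip 2 c)"
    and disj: "column_strip 2 c \<inter> M = {}"
  shows "imbalance (M \<union> column_strip 2 c) M = (- 1) ^ Suc (snd c)"
proof -
  obtain i j where c: "c = (i, j)" by (cases c)
  have eq: "M \<union> column_strip 2 c = insert (Suc i, j) (insert (i, j) M)"
    by (auto simp: c column_strip_2)
  have notin: "(i, j) \<notin> M" "(Suc i, j) \<notin> M" using disj by (auto simp: c column_strip_2)
  have L': "diagram (insert (Suc i, j) (insert (i, j) M))" using L unfolding eq .
  have "1 \<le> j" using diagram_pos_Pair[OF L', of i j] by simp
  have "imbalance (insert (Suc i, j) (insert (i, j) M)) M =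
      insertion_sign (insert (i, j) M) (Suc i, j) * insertion_sign M (i, j)"
    using notin by (intro imbalance_insert_ordered[OF M L']) (simp_all add: less_prod_def)
  also have "\<dots> = (- 1) ^ (j - 1) *
      (insertion_sign (insert (i, j) M) (Suc i, j) * insertion_sign (insert (i, j) M) (Suc i, j))"
    unfolding insertion_sign_column_domino[OF M L' notin] by (simp add: mult_ac)
  also have "\<dots> = (- 1) ^ Suc (snd c)"
    using \<open>1 \<le> j\<close> by (cases j) (simp_all add: insertion_sign_square c)
  finally show ?thesis by (simp add: eq)
qed

lemma domino_if_less:
  assumes L: "diagram L" and M: "diagram M" and LM: "L - M = {c, d}" and less: "c < d"
  shows "L - M = row_strip 2 c \<or> L - M = column_strip 2 c"
proof -
  have "c \<in> L" "d \<in> L" "c \<notin> M" using LM by auto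
  then have pos: "(1, 1) \<le> c" using diagram_pos[OF L] by blast
  have between: "e = c \<or> e = d" if "c \<le> e" "e \<le> d" for e
  proof -
    have "e \<in> L" using diagram_downward[OF L \<open>d \<in> L\<close>] pos that by (meson order_trans)
    moreover have "e \<notin> M" using diagram_downward[OF M _ pos] \<open>c \<notin> M\<close> that by blast
    ultimately show ?thesis using LM by blast
  qed
  obtain i j i' j' where ij: "c = (i, j)" "d = (i', j')" by (cases c, cases d)
  show ?thesis
  proof (cases "i = i'")
    case True
    then have "d = (i, Suc j)" using between[of "(i, Suc j)"] less ij by (auto simp: less_prod_def)
    then show ?thesis by (simp add: LM ij row_strip_2)
  next
    case False
    then have "d = (Suc i, j)" using between[of "(Suc i, j)"] less ij by (auto simp: less_prod_def)
    then show ?thesis by (simp add: LM ij column_strip_2)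
  qed
qed

lemma imbalance_eq_0_if_not_domino:
  assumes L: "diagram L" and M: "diagram M" and sub: "M \<subseteq> L" and card: "card (L - M) = 2"
    and row: "\<And>c. L - M \<noteq> row_strip 2 c" and column: "\<And>c. L - M \<noteq> column_strip 2 c"
  shows "imbalance L M = 0"
proof -
  obtain c d where cd: "L - M = {c, d}" "c \<noteq> d" using card by (auto simp: card_2_iff)
  have "\<not> c < d" "\<not> d < c"
    using domino_if_less[OF L M, of c d] domino_if_less[OF L M, of d c] cd row column
    by (auto simp: insert_commute)
  then have "maximal_cells (L - M) = {c, d}"
    unfolding cd using cd(2) by (auto simp: maximal_cells_def le_less)
  then have "c \<in> removable L" "d \<in> removable L"
    using maximal_cells_skew[OF L M] by auto
  moreover have "L = insert d (insert c M)" "L - {d} = insert c M" "L - {c} = insert d M"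
    using cd sub by auto
  ultimately have "c \<in> addable M" "d \<in> addable M" "d \<in> addable (insert c M)"
    using L M cd by (auto simp: removable_def addable_def)
  then show ?thesis using \<open>L = insert d (insert c M)\<close> by (simp add: imbalance_insert_insert)
qed

lemma inj_row_strip_2: "inj (row_strip 2)"
  by (auto simp: inj_def row_strip_2 doubleton_eq_iff)

lemma inj_column_strip_2: "inj (column_strip 2)"
  by (auto simp: inj_def column_strip_2 doubleton_eq_iff)

lemma row_strip_2_neq_column_strip_2: "row_strip 2 c \<noteq> column_strip 2 d"
  by (cases c; cases d) (auto simp: row_strip_2 column_strip_2 doubleton_eq_iff)

lemma card_dominoes: "card (row_strip 2 c) = 2" "card (column_strip 2 c) = 2"
  by (simp_all add: row_strip_def column_strip_def card_cartesian_product)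

definition domino_sign :: "cell set \<Rightarrow> int" where
  "domino_sign D = (if D \<in> range (row_strip 2) then 1
     else if D \<in> range (column_strip 2) then (- 1) ^ Suc (the_elem (snd ` D)) else 0)"

lemma domino_sign_row_strip: "domino_sign (row_strip 2 c) = 1"
  by (simp add: domino_sign_def)

lemma domino_sign_column_strip: "domino_sign (column_strip 2 c) = (- 1) ^ Suc (snd c)"
proof -
  have "snd ` column_strip 2 c = {snd c}" by (simp add: column_strip_def)
  moreover have "column_strip 2 c \<notin> range (row_strip 2)"
    using row_strip_2_neq_column_strip_2 by fastforce
  ultimately show ?thesis by (simp add: domino_sign_def)
qed

lemma imbalance_card_2:
  assumes "diagram L" "diagram M" "M \<subseteq> L" "card (L - M) = 2"
  shows "imbalance L M = domino_sign (L - M)"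
proof -
  consider c where "L - M = row_strip 2 c" | c where "L - M = column_strip 2 c"
    | "L - M \<notin> range (row_strip 2)" "L - M \<notin> range (column_strip 2)" by blast
  then show ?thesis
  proof cases
    case (1 c)
    then have "M \<union> row_strip 2 c = L" "row_strip 2 c \<inter> M = {}" using assms(3) by blast+
    then show ?thesis
      using imbalance_row_domino[of M c] assms(1,2) 1 by (simp add: domino_sign_row_strip)
  next
    case (2 c)
    then have "M \<union> column_strip 2 c = L" "column_strip 2 c \<inter> M = {}" using assms(3) by blast+
    then show ?thesis
      using imbalance_column_domino[of M c] assms(1,2) 2 by (simp add: domino_sign_column_strip)
  next
    case 3
    then have "imbalance L M = 0"
      using assms by (intro imbalance_eq_0_if_not_domino) auto
    then show ?thesis using 3 by (simp add: domino_sign_def)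
  qed
qed

lemma sum_domino_sign:
  assumes fin: "finite \<D>"
  shows "(\<Sum>D\<in>\<D>. prod w D * of_int (domino_sign D)) =
    (\<Sum>c | row_strip 2 c \<in> \<D>. prod w (row_strip 2 c)) +
    (\<Sum>c | column_strip 2 c \<in> \<D>. (- 1) ^ Suc (snd c) * prod w (column_strip 2 c))"
proof -
  let ?R = "row_strip 2 -` \<D>" and ?C = "column_strip 2 -` \<D>"
  let ?g = "\<lambda>D. prod w D * of_int (domino_sign D)"
  have "sum ?g \<D> = sum ?g (row_strip 2 ` ?R \<union> column_strip 2 ` ?C)"
    using fin by (intro sum.mono_neutral_right) (auto simp: domino_sign_def)
  also have "\<dots> = sum ?g (row_strip 2 ` ?R) + sum ?g (column_strip 2 ` ?C)"
    using fin row_strip_2_neq_column_strip_2 by (intro sum.union_disjoint) auto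
  also have "sum ?g (row_strip 2 ` ?R) = (\<Sum>c\<in>?R. prod w (row_strip 2 c))"
    by (subst sum.reindex) (simp_all add: inj_on_subset[OF inj_row_strip_2] domino_sign_row_strip)
  also have "sum ?g (column_strip 2 ` ?C) =
      (\<Sum>c\<in>?C. (- 1) ^ Suc (snd c) * prod w (column_strip 2 c))"
    by (subst sum.reindex)
      (simp_all add: inj_on_subset[OF inj_column_strip_2] domino_sign_column_strip mult.commute)
  finally show ?thesis by (simp add: vimage_def)
qed

lemma sum_above_2:
  assumes M: "diagram M"
  shows "sum_above w 2 M = (\<Sum>c\<in>addable_at (row_strip 2) M. prod w (row_strip 2 c)) +
    (\<Sum>c\<in>addable_at (column_strip 2) M. (- 1) ^ Suc (snd c) * prod w (column_strip 2 c))"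
proof -
  define \<D> where "\<D> = {D. D \<inter> M = {} \<and> diagram (M \<union> D) \<and> card D = 2}"
  have diff: "M \<union> D - M = D" if "D \<inter> M = {}" for D using that by blast
  have bij: "bij_betw (\<lambda>L. L - M) (diagrams_above 2 M) \<D>"
    by (rule bij_betw_byWitness[where f' = "\<lambda>D. M \<union> D"])
      (auto simp: diagrams_above_def \<D>_def Un_absorb1 diff)
  have "sum_above w 2 M = (\<Sum>D\<in>\<D>. prod w D * of_int (domino_sign D))"
    unfolding sum_above_def weighted_imbalance_def sum.reindex_bij_betw[OF bij, symmetric]
    using M by (intro sum.cong refl) (simp add: diagrams_above_def imbalance_card_2)
  moreover have "finite \<D>"
    using bij_betw_finite[OF bij] finite_diagrams_above[OF diagram_finite[OF M]] by blast
  moreover have "{c. row_strip 2 c \<in> \<D>} = addable_at (row_strip 2) M"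
    "{c. column_strip 2 c \<in> \<D>} = addable_at (column_strip 2) M"
    by (auto simp: \<D>_def addable_at_def card_dominoes)
  ultimately show ?thesis by (simp only: sum_domino_sign)
qed

lemma sum_below_2:
  assumes L: "diagram L"
  shows "sum_below w 2 L = (\<Sum>c\<in>removable_at (row_strip 2) L. prod w (row_strip 2 c)) +
    (\<Sum>c\<in>removable_at (column_strip 2) L. (- 1) ^ Suc (snd c) * prod w (column_strip 2 c))"
proof -
  define \<D> where "\<D> = {D. D \<subseteq> L \<and> diagram (L - D) \<and> card D = 2}"
  have bij: "bij_betw (\<lambda>M. L - M) (diagrams_below 2 L) \<D>"
    by (rule bij_betw_byWitness[where f' = "\<lambda>D. L - D"])
      (auto simp: diagrams_below_def \<D>_def double_diff)
  have "sum_below w 2 L = (\<Sum>D\<in>\<D>. prod w D * of_int (domino_sign D))"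
    unfolding sum_below_def weighted_imbalance_def sum.reindex_bij_betw[OF bij, symmetric]
    using L by (intro sum.cong refl) (simp add: diagrams_below_def imbalance_card_2)
  moreover have "finite \<D>"
    using bij_betw_finite[OF bij] finite_diagrams_below[OF diagram_finite[OF L]] by blast
  moreover have "{c. row_strip 2 c \<in> \<D>} = removable_at (row_strip 2) L"
    "{c. column_strip 2 c \<in> \<D>} = removable_at (column_strip 2) L"
    by (auto simp: \<D>_def removable_at_def card_dominoes)
  ultimately show ?thesis by (simp only: sum_domino_sign)
qed

lemma sum_above_2_eq_sum_below_2:
  fixes w w' :: "cell \<Rightarrow> 'a::comm_ring_1"
  assumes S: "diagram S"
    and row: "\<And>c. prod w (row_strip 2 c) = h (fst c)"
      "\<And>c. q * prod w' (row_strip 2 c) = h (Suc (fst c))"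
    and column: "\<And>c. (- 1) ^ Suc (snd c) * prod w (column_strip 2 c) = g (snd c)"
      "\<And>c. q * ((- 1) ^ Suc (snd c) * prod w' (column_strip 2 c)) = g (Suc (snd c))"
  shows "sum_above w 2 S = q * sum_below w' 2 S + (h 1 + g 1)"
proof -
  have "sum_above w 2 S =
      (\<Sum>c\<in>addable_at (row_strip 2) S. h (fst c)) + (\<Sum>c\<in>addable_at (column_strip 2) S. g (snd c))"
    unfolding sum_above_2[OF S] row column ..
  also have "\<dots> = (h 1 + (\<Sum>c\<in>removable_at (row_strip 2) S. h (Suc (fst c)))) +
      (g 1 + (\<Sum>c\<in>removable_at (column_strip 2) S. g (Suc (snd c))))"
    using S by (simp add: sum_addable_at_row_strip sum_addable_at_column_strip)
  also have "\<dots> = q * sum_below w' 2 S + (h 1 + g 1)"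
    unfolding sum_below_2[OF S] distrib_left sum_distrib_left row column by simp
  finally show ?thesis .
qed

subsection \<open>Exponential generating functions\<close>

lemma egf_recurrence:
  fixes b :: "nat \<Rightarrow> nat \<Rightarrow> 'a::field_char_0"
  assumes rec: "\<And>n k. b (Suc n) k = b n (Suc k) + c * b n k"
  shows "Abs_fps (\<lambda>n. b n 0 / fact n) = Abs_fps (\<lambda>k. b 0 k / fact k) * fps_exp c"
proof -
  define E where "E k = Abs_fps (\<lambda>n. b n k / fact n) * fps_exp (- c)" for k
  have inverse_exp: "fps_exp (- c) * fps_exp c = 1"
    by (simp flip: fps_exp_add_mult)
  have "fps_deriv (Abs_fps (\<lambda>n. b n k / fact n)) =
      Abs_fps (\<lambda>n. b n (Suc k) / fact n) + fps_const c * Abs_fps (\<lambda>n. b n k / fact n)" for k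
    by (rule fps_ext) (simp add: rec del: of_nat_Suc flip: add_divide_distrib)
  then have deriv: "fps_deriv (E k) = E (Suc k)" for k
    by (simp add: E_def algebra_simps flip: fps_const_neg)
  have "fps_nth_deriv k (E j) = E (j + k)" for j k
    by (induction k arbitrary: j) (simp_all add: deriv)
  then have "fact k * fps_nth (E 0) k = b 0 k" for k
    using fps_deriv_maclauren_0[of k "E 0"] by (simp add: E_def)
  then have "E 0 = Abs_fps (\<lambda>k. b 0 k / fact k)"
    by (intro fps_ext) (simp add: field_simps)
  moreover have "E 0 * fps_exp c = Abs_fps (\<lambda>n. b n 0 / fact n)"
    by (simp add: E_def mult.assoc inverse_exp)
  ultimately show ?thesis by simp
qed

lemma funpow_linear:
  fixes F :: "('b \<Rightarrow> 'a::comm_ring_1) \<Rightarrow> 'b \<Rightarrow> 'a"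
  assumes "\<And>a b f g. F (\<lambda>S. a * f S + b * g S) = (\<lambda>S. a * F f S + b * F g S)"
  shows "(F ^^ m) (\<lambda>S. a * f S + b * g S) = (\<lambda>S. a * (F ^^ m) f S + b * (F ^^ m) g S)"
  by (induction m) (simp_all add: assms)

lemma egf_commuting_operators:
  fixes U D :: "('b \<Rightarrow> 'a::field_char_0) \<Rightarrow> 'b \<Rightarrow> 'a"
  assumes U: "\<And>a b f g. U (\<lambda>S. a * f S + b * g S) = (\<lambda>S. a * U f S + b * U g S)"
    and D: "\<And>a b f g. D (\<lambda>S. a * f S + b * g S) = (\<lambda>S. a * D f S + b * D g S)"
    and commute: "\<And>f. U (U (D f)) = D (U (U f))"
    and one: "U (U e) = (\<lambda>S. q * D (D e) S + s * e S)"
  shows "Abs_fps (\<lambda>n. (U ^^ (2 * n)) e S / fact n) =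
    Abs_fps (\<lambda>n. (D ^^ (2 * n)) e S * q ^ n / fact n) * fps_exp s"
proof -
  define b where "b n k = (U ^^ (2 * n)) ((D ^^ (2 * k)) e) S * q ^ k" for n k
  have commute_funpow: "U (U ((D ^^ m) f)) = (D ^^ m) (U (U f))" for m f
    by (induction m) (simp_all add: commute)
  have "b (Suc n) k = b n (Suc k) + s * b n k" for n k
  proof -
    have "(U ^^ (2 * Suc n)) ((D ^^ (2 * k)) e) = (U ^^ (2 * n)) ((D ^^ (2 * k)) (U (U e)))"
      by (simp add: funpow_swap1 flip: commute_funpow)
    also have "\<dots> = (\<lambda>S. q * (U ^^ (2 * n)) ((D ^^ (2 * Suc k)) e) S +
        s * (U ^^ (2 * n)) ((D ^^ (2 * k)) e) S)"
      by (simp add: one funpow_linear[OF U] funpow_linear[OF D] funpow_swap1)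
    finally show ?thesis by (simp add: b_def algebra_simps)
  qed
  from egf_recurrence[of b, OF this] show ?thesis by (simp add: b_def)
qed

subsection \<open>Weights by parity of row and column\<close>

definition cell_wt :: "'a::comm_monoid_mult \<Rightarrow> 'a \<Rightarrow> 'a \<Rightarrow> cell \<Rightarrow> 'a" where
  "cell_wt x y z c = (if even (fst c) then x else 1) * (if even (snd c) then y else 1) *
     (if even (fst c) \<and> even (snd c) then z else 1)"

abbreviation dual_cell_wt :: "'a::field \<Rightarrow> 'a \<Rightarrow> 'a \<Rightarrow> cell \<Rightarrow> 'a" where
  "dual_cell_wt x y z \<equiv> cell_wt (inverse (- x)) (inverse y) (inverse z)"

lemma prod_cell_wt:
  assumes "finite D"
  shows "prod (cell_wt x y z) D = x ^ v_stat D * y ^ h_stat D * z ^ d_stat D"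
proof -
  have prod_if: "(\<Prod>c\<in>D. if P c then u else 1) = u ^ card {c \<in> D. P c}" for u :: 'a and P
    using assms by (simp add: prod.If_cases Int_def)
  have "{(i, j) \<in> D. even i} = {c \<in> D. even (fst c)}" "{(i, j) \<in> D. even j} = {c \<in> D. even (snd c)}"
    "{(i, j) \<in> D. even i \<and> even j} = {c \<in> D. even (fst c) \<and> even (snd c)}" by auto
  then show ?thesis
    by (simp add: cell_wt_def prod.distrib prod_if v_stat_def h_stat_def d_stat_def)
qed

lemma cell_wt_mult_dual:
  assumes "x \<noteq> 0" "y \<noteq> 0" "z \<noteq> 0"
  shows "cell_wt x y z c * dual_cell_wt x y z c = (- 1) ^ Suc (fst c)"
  using assms by (auto simp: cell_wt_def field_simps)

lemma sum_partitions_eq_sum_diagrams: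
  "(\<Sum>lam | is_partition lam \<and> P (young lam). g (young lam)) = (\<Sum>S | diagram S \<and> P S. g S)"
proof (rule sum.reindex_bij_betw)
  have "bij_betw young {lam \<in> {lam. is_partition lam}. P (young lam)} {S \<in> {S. diagram S}. P S}"
    using bij_betw_young by (rule bij_betw_Collect) simp
  then show "bij_betw young {lam. is_partition lam \<and> P (young lam)} {S. diagram S \<and> P S}"
    by simp
qed

lemma F_plus_eq_sum_above:
  "F_plus x y z alpha m = sum_above (cell_wt x y z) m (young alpha)"
proof -
  have "F_plus x y z alpha m =
      (\<Sum>lam | is_partition lam \<and> young alpha \<subseteq> young lam \<and> card (young lam - young alpha) = m.
        weighted_imbalance (cell_wt x y z) (young lam) (young alpha))"
    unfolding F_plus_def skew_def weighted_imbalance_def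
    by (intro sum.cong refl) (simp add: prod_cell_wt finite_young sign_imbalance_eq_imbalance)
  then show ?thesis
    unfolding sum_above_def diagrams_above_def
    using sum_partitions_eq_sum_diagrams
      [where P = "\<lambda>L. young alpha \<subseteq> L \<and> card (L - young alpha) = m"]
    by simp
qed

lemma F_minus_eq_sum_below:
  "F_minus x y z alpha m = sum_below (dual_cell_wt x y z) m (young alpha)"
proof -
  have "F_minus x y z alpha m =
      (\<Sum>mu | is_partition mu \<and> young mu \<subseteq> young alpha \<and> card (young alpha - young mu) = m.
        weighted_imbalance (dual_cell_wt x y z) (young alpha) (young mu))"
    unfolding F_minus_def skew_def weighted_imbalance_def
    by (intro sum.cong refl)
      (simp add: prod_cell_wt finite_young sign_imbalance_eq_imbalance power_int_minus power_inverse
        del: inverse_minus_eq)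
  then show ?thesis
    unfolding sum_below_def diagrams_below_def
    using sum_partitions_eq_sum_diagrams
      [where P = "\<lambda>M. M \<subseteq> young alpha \<and> card (young alpha - M) = m"]
    by simp
qed

lemma sum_above_2_cell_wt:
  assumes S: "diagram S" and nonzero: "x \<noteq> 0" "y \<noteq> 0" "z \<noteq> 0"
  shows "sum_above (cell_wt x y z) 2 S =
    x\<^sup>2 * y\<^sup>2 * z * sum_below (dual_cell_wt x y z) 2 S + (x + y)"
proof -
  let ?h = "\<lambda>i::nat. if even i then x\<^sup>2 * y * z else y"
  let ?g = "\<lambda>j::nat. if even j then - (x * y\<^sup>2 * z) else x"
  have "sum_above (cell_wt x y z) 2 S = x\<^sup>2 * y\<^sup>2 * z *
      sum_below (dual_cell_wt x y z) 2 S + (?h 1 + ?g 1)"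
  proof (rule sum_above_2_eq_sum_below_2[OF S])
    fix c :: cell
    obtain i j where c: "c = (i, j)" by (cases c)
    show "prod (cell_wt x y z) (row_strip 2 c) = ?h (fst c)"
      "x\<^sup>2 * y\<^sup>2 * z * prod (dual_cell_wt x y z) (row_strip 2 c) = ?h (Suc (fst c))"
      using nonzero by (auto simp: c row_strip_2 cell_wt_def field_simps power2_eq_square)
    show "(- 1) ^ Suc (snd c) * prod (cell_wt x y z) (column_strip 2 c) = ?g (snd c)"
      "x\<^sup>2 * y\<^sup>2 * z * ((- 1) ^ Suc (snd c) *
        prod (dual_cell_wt x y z) (column_strip 2 c)) = ?g (Suc (snd c))"
      using nonzero by (auto simp: c column_strip_2 cell_wt_def field_simps power2_eq_square)
  qed
  then show ?thesis by (simp add: add.commute)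
qed

lemma up_up_diagram_indicator:
  fixes x y z :: "'a::field"
  assumes "x \<noteq> 0" "y \<noteq> 0" "z \<noteq> 0"
  defines "w \<equiv> cell_wt x y z" and "w' \<equiv> dual_cell_wt x y z"
  shows "up_op w (up_op w diagram_indicator) =
    (\<lambda>S. x\<^sup>2 * y\<^sup>2 * z * down_op w' (down_op w' diagram_indicator) S + (x + y) * diagram_indicator S)"
proof
  fix S
  show "up_op w (up_op w diagram_indicator) S =
    x\<^sup>2 * y\<^sup>2 * z * down_op w' (down_op w' diagram_indicator) S + (x + y) * diagram_indicator S"
  proof (cases "diagram S")
    case True
    then show ?thesis
      using sum_above_2_cell_wt[OF True assms(1-3)] unfolding w_def w'_def
      by (simp add: sum_above_eq_funpow sum_below_eq_funpow numeral_2_eq_2 diagram_indicator_def)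
  next
    case False
    then show ?thesis by (simp add: up_op_eq_0 down_op_def removable_def diagram_indicator_def)
  qed
qed

theorem theorem4p9:
  fixes x y z :: "'a::field_char_0" and alpha :: "nat list"
  assumes "is_partition alpha" and "x \<noteq> 0" and "y \<noteq> 0" and "z \<noteq> 0"
  shows "Abs_fps (\<lambda>n. F_plus x y z alpha (2 * n) / fact n)
       / Abs_fps (\<lambda>n. F_minus x y z alpha (2 * n) * (x\<^sup>2 * y\<^sup>2 * z) ^ n / fact n)
       = fps_exp (x + y)"
proof -
  let ?U = "up_op (cell_wt x y z)"
  let ?D = "down_op (dual_cell_wt x y z)"
  define G where "G = Abs_fps (\<lambda>n. F_minus x y z alpha (2 * n) * (x\<^sup>2 * y\<^sup>2 * z) ^ n / fact n)"
  have alpha: "diagram (young alpha)" using assms(1) by (rule diagram_young)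
  have F: "F_plus x y z alpha m = (?U ^^ m) diagram_indicator (young alpha)"
    "F_minus x y z alpha m = (?D ^^ m) diagram_indicator (young alpha)" for m
    by (simp_all only: F_plus_eq_sum_above F_minus_eq_sum_below
        sum_above_eq_funpow[OF alpha] sum_below_eq_funpow[OF alpha])
  have commute: "?U (?U (?D f)) = ?D (?U (?U f))" for f
    by (rule up_up_down_commute) (rule cell_wt_mult_dual[OF assms(2-4)])
  have "Abs_fps (\<lambda>n. F_plus x y z alpha (2 * n) / fact n) = G * fps_exp (x + y)"
    unfolding G_def F
    by (rule egf_commuting_operators[OF up_op_linear down_op_linear commute
          up_up_diagram_indicator[OF assms(2-4)]])
  moreover have "fps_nth G 0 = 1"
    using alpha by (simp add: G_def F diagram_indicator_def)
  then have "G \<noteq> 0" by auto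
  ultimately show ?thesis by (simp add: G_def)
qed

end
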